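(* Let $n\geq 7$ be an integer, let $k=\lceil n/3\rceil$, and let $G$ be a graph with minimum spectral radius among all simple connected graphs of order $n$ with independence number $\lceil n/2\rceil-1$. Then \[ G \cong \begin{cases} C_n, & \text{if $n$ is odd},\\ B(k+1,k-1,k+1), & \text{if } n\equiv 0 \pmod 6,\\ B(k,k,k), & \text{if } n\equiv 2 \pmod 6,\\ B(k-1,k+1,k-1), & \text{if } n\equiv 4 \pmod 6. \end{cases} \]
   Context: All graphs are simple and undirected. The spectral radius $\rho(G)$ of a graph is the largest eigenvalue of its adjacency matrix. The independence number $\alpha(G)$ is the maximum size of a set of pairwise non-adjacent vertices. $C_n$ is the cycle on $n$ vertices. $P_p$ denotes the path with $p$ edges. For integers $m,q\ge 3$ and $p\ge 1$, $B(m,p,q)$ is the graph obtained from a path $P_p$ (with $p$ edges) by identifying one end vertex of the path with a vertex of a cycle $C_m$ and the other end vertex with a vertex of a (disjoint) cycle $C_q$; it has $m+p+q-1$ vertices. *)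

theory Defs
  imports "Graph_Theory.Graph_Theory" "Jordan_Normal_Form.Char_Poly"
begin

text \<open>
  A finite simple undirected graph is a \<^locale>\<open>pair_graph\<close>: a finite, loop-free, symmetric
  digraph without parallel arcs. An edge between \<open>u\<close> and \<open>v\<close> is the pair of
  arcs \<open>(u, v)\<close> and \<open>(v, u)\<close>, so that isomorphism of graphs is
  \<^const>\<open>digraph_iso\<close> of the symmetric digraphs.
\<close>

definition independent_set :: "'a pair_pre_digraph \<Rightarrow> 'a set \<Rightarrow> bool" where
  "independent_set G S \<longleftrightarrow> S \<subseteq> pverts G \<and> (\<forall>u\<in>S. \<forall>v\<in>S. (u, v) \<notin> parcs G)"

definition independence_number :: "'a pair_pre_digraph \<Rightarrow> nat" where
  "independence_number G = Max (card ` {S. independent_set G S})"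

definition adjacency_matrix_along :: "'a list \<Rightarrow> 'a pair_pre_digraph \<Rightarrow> real mat" where
  "adjacency_matrix_along vs G =
     mat (length vs) (length vs) (\<lambda>(i, j). of_bool ((vs ! i, vs ! j) \<in> parcs G))"

text \<open>
  Rows and columns of the adjacency matrix follow an arbitrarily chosen enumeration of the
  vertices; by the lemma \<open>eigenvalue_adjacency_matrix_along_cong\<close> below, the eigenvalues do not
  depend on the choice.
\<close>

definition adjacency_matrix :: "'a pair_pre_digraph \<Rightarrow> real mat" where
  "adjacency_matrix G =
     adjacency_matrix_along (SOME vs. distinct vs \<and> set vs = pverts G) G"

definition graph_spectral_radius :: "'a pair_pre_digraph \<Rightarrow> real" where
  "graph_spectral_radius G = Max {x. eigenvalue (adjacency_matrix G) x}"

lemma eigenvalue_adjacency_matrix_along_iff: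
  assumes "distinct vs"
  shows "eigenvalue (adjacency_matrix_along vs G) x \<longleftrightarrow>
    (\<exists>f. (\<exists>u\<in>set vs. f u \<noteq> 0) \<and>
         (\<forall>u\<in>set vs. (\<Sum>v\<in>set vs. of_bool ((u, v) \<in> parcs G) * f v) = x * f u))"
    (is "?L \<longleftrightarrow> ?R")
proof -
  let ?n = "length vs" and ?A = "adjacency_matrix_along vs G"
  have dim: "dim_row ?A = ?n" "dim_col ?A = ?n"
    by (simp_all add: adjacency_matrix_along_def)
  have bij: "bij_betw (\<lambda>i. vs ! i) {0..<?n} (set vs)"
    using bij_betw_nth[OF assms, of "{0..<?n}" "set vs"] by (simp add: atLeast0LessThan)
  have mult: "(?A *\<^sub>v w) $ i = (\<Sum>v\<in>set vs. of_bool ((vs ! i, v) \<in> parcs G) * f v)"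
    if "i < ?n" "dim_vec w = ?n" "\<And>j. j < ?n \<Longrightarrow> w $ j = f (vs ! j)" for w i f
  proof -
    have "(?A *\<^sub>v w) $ i = (\<Sum>j\<in>{0..<?n}. of_bool ((vs ! i, vs ! j) \<in> parcs G) * f (vs ! j))"
      using that by (simp add: adjacency_matrix_along_def scalar_prod_def)
    also have "\<dots> = (\<Sum>v\<in>set vs. of_bool ((vs ! i, v) \<in> parcs G) * f v)"
      by (rule sum.reindex_bij_betw[OF bij])
    finally show ?thesis .
  qed
  show ?thesis
  proof
    assume ?L
    then obtain w where w: "dim_vec w = ?n" "w \<noteq> 0\<^sub>v ?n" "?A *\<^sub>v w = x \<cdot>\<^sub>v w"
      unfolding eigenvalue_def eigenvector_def dim carrier_vec_def by auto
    define f where "f v = w $ (the_inv_into {0..<?n} (\<lambda>i. vs ! i) v)" for v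
    have f: "w $ j = f (vs ! j)" if "j < ?n" for j
      using the_inv_into_f_f[OF bij_betw_imp_inj_on[OF bij], of j] that by (simp add: f_def)
    have "\<exists>i<?n. w $ i \<noteq> 0"
    proof (rule ccontr)
      assume "\<not> ?thesis"
      then have "w = 0\<^sub>v ?n" using w(1) by (intro eq_vecI) auto
      then show False using w(2) by contradiction
    qed
    then obtain i where i: "i < ?n" "w $ i \<noteq> 0" by blast
    have "f (vs ! i) \<noteq> 0" using i f[OF i(1)] by simp
    then have 1: "\<exists>u\<in>set vs. f u \<noteq> 0"
      using nth_mem[OF i(1)] by (rule bexI)
    have 2: "(\<Sum>v\<in>set vs. of_bool ((u, v) \<in> parcs G) * f v) = x * f u" if "u \<in> set vs" for u
    proof -
      from that obtain i where i: "i < ?n" "u = vs ! i" by (auto simp: in_set_conv_nth)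
      have "(?A *\<^sub>v w) $ i = x * w $ i" using w(1,3) i(1) by simp
      then show ?thesis using mult[OF i(1) w(1) f] f[OF i(1)] i(2) by simp
    qed
    show ?R
      by (rule exI[of _ f], rule conjI[OF 1], rule ballI, rule 2)
  next
    assume ?R
    then obtain f where f: "\<exists>u\<in>set vs. f u \<noteq> 0"
      "\<forall>u\<in>set vs. (\<Sum>v\<in>set vs. of_bool ((u, v) \<in> parcs G) * f v) = x * f u" by blast
    define w where "w = vec ?n (\<lambda>i. f (vs ! i))"
    have "w \<noteq> 0\<^sub>v ?n"
    proof
      assume w0: "w = 0\<^sub>v ?n"
      obtain i where i: "i < ?n" "f (vs ! i) \<noteq> 0"
        using f(1) by (auto simp: in_set_conv_nth)
      have "w $ i = 0" using w0 i(1) by simp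
      then show False using i by (simp add: w_def)
    qed
    moreover have "?A *\<^sub>v w = x \<cdot>\<^sub>v w"
    proof (rule eq_vecI)
      fix i assume "i < dim_vec (x \<cdot>\<^sub>v w)"
      then have i: "i < ?n" by (simp add: w_def)
      show "(?A *\<^sub>v w) $ i = (x \<cdot>\<^sub>v w) $ i"
        using mult[OF i, of w f] f(2) i by (simp add: w_def)
    qed (simp add: w_def dim)
    moreover have "w \<in> carrier_vec ?n" by (simp add: w_def)
    ultimately have "eigenvector ?A w x"
      unfolding eigenvector_def dim by blast
    then show ?L unfolding eigenvalue_def by blast
  qed
qed

lemma eigenvalue_adjacency_matrix_along_cong:
  assumes "distinct vs" "distinct ws" "set vs = set ws"
  shows "eigenvalue (adjacency_matrix_along vs G) x \<longleftrightarrow>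
         eigenvalue (adjacency_matrix_along ws G) x"
  using assms by (simp add: eigenvalue_adjacency_matrix_along_iff)

definition connected_graphs :: "nat \<Rightarrow> int \<Rightarrow> 'a pair_pre_digraph set" where
  "connected_graphs n a = {G. pair_graph G \<and> Digraph_Component.connected (with_proj G) \<and>
     card (pverts G) = n \<and> int (independence_number G) = a}"

text \<open>Arcs of a cycle on \<open>a, ..., a + m - 1\<close> (for \<open>m \<ge> 3\<close>)
  and of a path with \<open>p\<close> edges on \<open>a, ..., a + p\<close>.\<close>

definition cycle_arcs :: "nat \<Rightarrow> nat \<Rightarrow> nat rel" where
  "cycle_arcs a m = {(a + i, a + (i + 1) mod m) | i. i < m}
                  \<union> {(a + (i + 1) mod m, a + i) | i. i < m}"

definition path_arcs :: "nat \<Rightarrow> nat \<Rightarrow> nat rel" where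
  "path_arcs a p = {(a + i, a + i + 1) | i. i < p} \<union> {(a + i + 1, a + i) | i. i < p}"

definition cycle_graph :: "nat \<Rightarrow> nat pair_pre_digraph" where
  "cycle_graph n = \<lparr>pverts = {..<n}, parcs = cycle_arcs 0 n\<rparr>"

text \<open>
  The graph \<open>B(m, p, q)\<close> for \<open>m, q \<ge> 3\<close> and \<open>p \<ge> 1\<close>: the cycle of length \<open>m\<close> lives on
  \<open>0, ..., m - 1\<close>, the path with \<open>p\<close> edges on \<open>m - 1, ..., m - 1 + p\<close> and the cycle of
  length \<open>q\<close> on \<open>m - 1 + p, ..., m + p + q - 2\<close>, so that exactly the two end vertices
  \<open>m - 1\<close> and \<open>m - 1 + p\<close> of the path are shared with the cycles.
\<close>

definition B_graph :: "nat \<Rightarrow> nat \<Rightarrow> nat \<Rightarrow> nat pair_pre_digraph" where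
  "B_graph m p q = \<lparr>pverts = {..<m + p + q - 1},
     parcs = cycle_arcs 0 m \<union> path_arcs (m - 1) p \<union> cycle_arcs (m - 1 + p) q\<rparr>"

end

theory Submission
  imports Defs "Jordan_Normal_Form.Spectral_Radius" "HOL-Analysis.Function_Topology"
begin

text \<open>
  If \<open>\<alpha>(G) < n/2\<close> then \<open>G\<close> has an odd cycle, and a test vector that is 1 on this cycle gives
  \<open>\<rho>(G) \<ge> 2\<close> with equality only for the cycle itself; this settles odd \<open>n\<close>.

  For even \<open>n\<close>, \<open>G - v\<close> is not bipartite for any vertex \<open>v\<close>, so \<open>G\<close> has a cycle through some \<open>v\<close> and
  another cycle avoiding \<open>v\<close>. It therefore contains a theta graph, two cycles sharing a vertex, or a
  dumbbell: three arcs of lengths \<open>a, b, c\<close> with \<open>a + b + c \<le> n + 1\<close> between branch vertices. Put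
  \<open>\<lambda> = 2 cosh (2s)\<close>. The vector \<open>x\<close> that is 1 at the branch vertices and solves
  \<open>x (i - 1) + x (i + 1) = \<lambda> x i\<close> along the arcs satisfies
  \<open>x\<^sup>T (A - \<lambda>) x = 2 (cosh 2s - sinh 2s (tanh (as) + tanh (bs) + tanh (cs)))\<close>
  on the subgraph. Let \<open>\<lambda>\<close> be the spectral radius of the claimed minimiser. The value is then positive
  unless \<open>a, b, c\<close> are almost equal, because \<open>tanh\<close> is concave. The few remaining triples are excluded
  by the parity of the cycles, or because \<open>x\<close> would have to be an eigenvector.
\<close>

section \<open>The Rayleigh principle for adjacency matrices\<close>

text \<open>The obstacle for even \<open>n\<close> is parity. For a given total, concavity of
  \<open>tanh\<close> favours lengths that differ by at most one, while the two cycles must be odd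
  and, since \<open>a + b + c = n + 1\<close> is odd as well, so must the connecting path. Odd
  totals have the forms 3m, 3m + 2 and 3p + 4 with m, p odd, and the most balanced odd triples are
  m, m, m, then m, m, m + 2, then p, p + 2, p + 2; this is where the residues modulo 6 come from. In
  the last two cases the triple m, m + 1, m + 1, respectively p + 1, p + 1, p + 2, has the larger
  sum, so concavity alone cannot exclude it. It could occur only with an edge beyond those of the
  lollipop, which adds twice a product of two entries of \<open>x\<close> to the form. That product
  is compared with an exact second difference of \<open>tanh\<close>, and the comparison succeeds
  because \<open>exp (2 * s) < 2\<close>, that is, \<lambda> < 5/2. Of the claimed minimiser only
  the bound \<rho> \<le> \<lambda> enters: \<lambda> is chosen such that \<open>x\<close> is a
  positive eigenvector there.\<close>

definition nbr_sum :: "'a set \<Rightarrow> 'a rel \<Rightarrow> ('a \<Rightarrow> real) \<Rightarrow> 'a \<Rightarrow> real" where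
  "nbr_sum V E f u = (\<Sum>v\<in>V. of_bool ((u, v) \<in> E) * f v)"

definition qform :: "'a set \<Rightarrow> 'a rel \<Rightarrow> real \<Rightarrow> ('a \<Rightarrow> real) \<Rightarrow> real" where
  "qform V E c f = (\<Sum>u\<in>V. f u * (nbr_sum V E f u - c * f u))"

lemma nbr_sum_add_scaled:
  "nbr_sum V E (\<lambda>v. f v + t * g v) u = nbr_sum V E f u + t * nbr_sum V E g u"
  by (simp add: nbr_sum_def algebra_simps sum.distrib sum_distrib_left)

lemma sum_mult_nbr_sum_commute:
  assumes "sym E"
  shows "(\<Sum>u\<in>V. f u * nbr_sum V E g u) = (\<Sum>u\<in>V. g u * nbr_sum V E f u)"
proof -
  have sym_arc: "(u, v) \<in> E \<longleftrightarrow> (v, u) \<in> E" for u v using assms by (auto dest: symD)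
  have "(\<Sum>u\<in>V. f u * nbr_sum V E g u) = (\<Sum>u\<in>V. \<Sum>v\<in>V. of_bool ((u, v) \<in> E) * f u * g v)"
    by (simp add: nbr_sum_def sum_distrib_left mult_ac)
  also have "\<dots> = (\<Sum>v\<in>V. \<Sum>u\<in>V. of_bool ((u, v) \<in> E) * f u * g v)"
    by (rule sum.swap)
  also have "\<dots> = (\<Sum>v\<in>V. \<Sum>u\<in>V. of_bool ((v, u) \<in> E) * f u * g v)"
    by (subst sym_arc) (rule refl)
  also have "\<dots> = (\<Sum>u\<in>V. g u * nbr_sum V E f u)"
    by (simp add: nbr_sum_def sum_distrib_left mult_ac)
  finally show ?thesis .
qed

lemma qform_add_scaled:
  assumes "sym E"
  shows "qform V E c (\<lambda>v. f v + t * g v) =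
    qform V E c f + 2 * t * (\<Sum>u\<in>V. g u * (nbr_sum V E f u - c * f u)) + t\<^sup>2 * qform V E c g"
proof -
  have "qform V E c (\<lambda>v. f v + t * g v) =
    qform V E c f + t * (\<Sum>u\<in>V. g u * (nbr_sum V E f u - c * f u))
     + t * (\<Sum>u\<in>V. f u * (nbr_sum V E g u - c * g u)) + t\<^sup>2 * qform V E c g"
    by (simp add: qform_def nbr_sum_add_scaled sum_distrib_left sum.distrib[symmetric]
        algebra_simps power2_eq_square)
  moreover have "(\<Sum>u\<in>V. f u * (nbr_sum V E g u - c * g u)) = (\<Sum>u\<in>V. g u * (nbr_sum V E f u - c * f u))"
    using sum_mult_nbr_sum_commute[OF assms, where V = V and f = f and g = g]
    by (simp add: right_diff_distrib sum_subtractf mult_ac)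
  ultimately show ?thesis by simp
qed

text \<open>A zero of a nonpositive form is a maximiser, so the first variation vanishes there; it
  is tested in the direction of the single vertex \<open>u\<close>.\<close>

lemma qform_eq_0_imp_eigen:
  assumes "finite V" "sym E" and nonpos: "\<And>g. qform V E c g \<le> 0" and "qform V E c f = 0" "u \<in> V"
  shows "nbr_sum V E f u = c * f u"
proof (rule ccontr)
  assume neq: "nbr_sum V E f u \<noteq> c * f u"
  define e :: "'a \<Rightarrow> real" where "e v = of_bool (v = u)" for v
  define d where "d = nbr_sum V E f u - c * f u"
  define Q where "Q = qform V E c e"
  have "(\<Sum>v\<in>V. e v * (nbr_sum V E f v - c * f v)) = d"
    using assms by (simp add: e_def d_def of_bool_def if_distrib[of "\<lambda>x. x * _"] cong: if_cong)
  then have *: "2 * t * d + t\<^sup>2 * Q \<le> 0" for t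
    using nonpos[of "\<lambda>v. f v + t * e v"] qform_add_scaled[OF assms(2), of V c f t e] assms(4)
    by (simp add: Q_def)
  have d: "d \<noteq> 0" using neq by (simp add: d_def)
  \<comment> \<open>The step \<open>d / P\<close> is so short that the quadratic term costs at most
    half of the linear one, which is positive.\<close>
  define P where "P = \<bar>Q\<bar> + 1"
  have P: "P > 0" by (simp add: P_def)
  define t where "t = d / P"
  have "0 < d\<^sup>2 / P * (2 + Q / P)"
  proof (rule mult_pos_pos)
    show "0 < d\<^sup>2 / P" using d P by simp
    have "- 1 \<le> Q / P" using P by (simp add: pos_le_divide_eq P_def)
    then show "0 < 2 + Q / P" by simp
  qed
  also have "\<dots> = 2 * t * d + t\<^sup>2 * Q"
    using P by (simp add: t_def field_simps power2_eq_square)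
  finally show False using *[of t] by simp
qed

text \<open>\<open>M\<close> is the maximum of \<open>N\<close> on the unit sphere and
  \<open>f\<close> a maximiser: the form with constant \<open>M\<close> is nonpositive and vanishes
  at \<open>f\<close>.\<close>

lemma ex_max_eigenvalue:
  fixes V :: "'a set"
  assumes fin: "finite V" and ne: "V \<noteq> {}" and "sym E"
  obtains M f where "\<exists>u\<in>V. f u \<noteq> 0" "\<And>u. u \<in> V \<Longrightarrow> nbr_sum V E f u = M * f u"
    "\<And>g. qform V E M g \<le> 0"
proof -
  define N where "N f = (\<Sum>u\<in>V. f u * nbr_sum V E f u)" for f
  have qN: "qform V E c f = N f - c * (\<Sum>u\<in>V. (f u)\<^sup>2)" for c f
    by (simp add: qform_def N_def right_diff_distrib sum_subtractf sum_distrib_left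
        power2_eq_square mult_ac)
  \<comment> \<open>The vertex type may be infinite, so functions on it carry the product topology;
    fixing the value 0 off \<open>V\<close> makes the box a product of compact sets.\<close>
  define box :: "('a \<Rightarrow> real) set" where "box = PiE UNIV (\<lambda>v. if v \<in> V then {-1..1} else {0})"
  define K where "K = box \<inter> {f. (\<Sum>u\<in>V. (f u)\<^sup>2) = 1}"
  have cont_coord: "continuous_on UNIV (\<lambda>f :: 'a \<Rightarrow> real. f v)" for v by simp
  have "compactin (product_topology (\<lambda>i. euclidean) UNIV) box"
    unfolding box_def by (subst compactin_PiE) auto
  then have "compact box" by (simp add: euclidean_product_topology)
  moreover have "closed {f :: 'a \<Rightarrow> real. (\<Sum>u\<in>V. (f u)\<^sup>2) = 1}"
    by (intro closed_Collect_eq continuous_intros cont_coord)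
  ultimately have "compact K" unfolding K_def by (rule compact_Int_closed)
  moreover have "continuous_on K N"
    unfolding N_def nbr_sum_def
    by (intro continuous_intros continuous_on_subset[OF cont_coord]) auto
  moreover have "K \<noteq> {}"
  proof -
    obtain u where u: "u \<in> V" using ne by blast
    define e :: "'a \<Rightarrow> real" where "e v = of_bool (v = u)" for v
    have "(\<Sum>v\<in>V. (e v)\<^sup>2) = (\<Sum>v\<in>V. if v = u then 1 else 0)"
      by (intro sum.cong) (auto simp: e_def)
    also have "\<dots> = 1" using fin u by simp
    finally have "e \<in> K" using u by (auto simp: K_def box_def e_def)
    then show ?thesis by blast
  qed
  ultimately obtain f where f: "f \<in> K" "\<And>g. g \<in> K \<Longrightarrow> N g \<le> N f"
    using continuous_attains_sup by metis
  define M where "M = N f"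
  have f1: "(\<Sum>u\<in>V. (f u)\<^sup>2) = 1" using f(1) by (simp add: K_def)
  have nonpos: "qform V E M g \<le> 0" for g
  proof (cases "(\<Sum>u\<in>V. (g u)\<^sup>2) = 0")
    case True
    then have "g u = 0" if "u \<in> V" for u
      using that fin by (simp add: sum_nonneg_eq_0_iff)
    then show ?thesis by (simp add: qform_def)
  next
    case False
    define S where "S = (\<Sum>u\<in>V. (g u)\<^sup>2)"
    have S: "S > 0" using False sum_nonneg[of V "\<lambda>u. (g u)\<^sup>2"] by (simp add: S_def)
    define h where "h v = (if v \<in> V then g v / sqrt S else 0)" for v
    have h1: "(\<Sum>u\<in>V. (h u)\<^sup>2) = 1"
      using S by (simp add: h_def power_divide sum_divide_distrib[symmetric] S_def[symmetric])
    have "\<bar>h v\<bar> \<le> 1" if "v \<in> V" for v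
    proof -
      have "(h v)\<^sup>2 \<le> 1" using member_le_sum[OF that, of "\<lambda>u. (h u)\<^sup>2"] fin h1 by simp
      then show ?thesis by (simp add: abs_square_le_1)
    qed
    then have "h v \<in> {-1..1}" if "v \<in> V" for v using that by (fastforce simp: abs_le_iff)
    then have "h \<in> K" using h1 by (auto simp: K_def box_def h_def)
    then have "N h \<le> M" using f(2) by (simp add: M_def)
    moreover have "N h = N g / S"
    proof -
      have "nbr_sum V E h u = nbr_sum V E g u / sqrt S" for u
        by (simp add: nbr_sum_def h_def sum_divide_distrib)
      then show ?thesis using S
        by (simp add: N_def h_def sum_divide_distrib[symmetric])
    qed
    ultimately show ?thesis using S by (simp add: qN S_def[symmetric] field_simps)
  qed
  moreover have "nbr_sum V E f u = M * f u" if "u \<in> V" for u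
    using qform_eq_0_imp_eigen[OF fin assms(3) nonpos _ that] by (simp add: qN f1 M_def)
  moreover have "\<exists>u\<in>V. f u \<noteq> 0"
    using f1 by (metis (no_types, lifting) power_zero_numeral sum.neutral zero_neq_one)
  ultimately show thesis using that by blast
qed

lemma eigenvalue_adjacency_matrix_iff:
  assumes "finite (pverts G)"
  shows "eigenvalue (adjacency_matrix G) x \<longleftrightarrow>
    (\<exists>f. (\<exists>u\<in>pverts G. f u \<noteq> 0) \<and> (\<forall>u\<in>pverts G. nbr_sum (pverts G) (parcs G) f u = x * f u))"
proof -
  define vs where "vs = (SOME vs. distinct vs \<and> set vs = pverts G)"
  have "\<exists>vs. distinct vs \<and> set vs = pverts G"
    using finite_distinct_list[OF assms] by blast
  then have "distinct vs \<and> set vs = pverts G"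
    unfolding vs_def by (rule someI_ex)
  then show ?thesis
    using eigenvalue_adjacency_matrix_along_iff[of vs G x]
    by (simp add: adjacency_matrix_def vs_def[symmetric] nbr_sum_def)
qed

lemma finite_adjacency_eigenvalues: "finite {x. eigenvalue (adjacency_matrix G) x}"
proof -
  have "adjacency_matrix G \<in> carrier_mat (dim_row (adjacency_matrix G)) (dim_row (adjacency_matrix G))"
    by (simp add: adjacency_matrix_def adjacency_matrix_along_def)
  from card_finite_spectrum(1)[OF this] show ?thesis
    by (simp add: spectrum_def)
qed

lemma qform_mono_const:
  assumes "c \<le> d"
  shows "qform V E d f \<le> qform V E c f"
  unfolding qform_def
proof (rule sum_mono)
  fix u
  have "c * (f u * f u) \<le> d * (f u * f u)" using assms by (rule mult_right_mono) simp
  then show "f u * (nbr_sum V E f u - d * f u) \<le> f u * (nbr_sum V E f u - c * f u)"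
    by (simp add: algebra_simps)
qed

text \<open>The maximum of the form on unit vectors is itself an eigenvalue, hence at most the
  spectral radius; raising the constant only lowers the form.\<close>

lemma qform_nonpos_if_spectral_radius_le:
  assumes "finite (pverts G)" "sym (parcs G)" "graph_spectral_radius G \<le> c"
  shows "qform (pverts G) (parcs G) c f \<le> 0"
proof (cases "pverts G = {}")
  case True
  then show ?thesis by (simp add: qform_def)
next
  case False
  obtain M h where M: "\<exists>u\<in>pverts G. h u \<noteq> 0"
    "\<And>u. u \<in> pverts G \<Longrightarrow> nbr_sum (pverts G) (parcs G) h u = M * h u"
    "\<And>g. qform (pverts G) (parcs G) M g \<le> 0"
    using ex_max_eigenvalue[OF assms(1) False assms(2)] by metis
  have "eigenvalue (adjacency_matrix G) M"
    unfolding eigenvalue_adjacency_matrix_iff[OF assms(1)] using M by blast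
  then have "M \<le> graph_spectral_radius G"
    unfolding graph_spectral_radius_def using finite_adjacency_eigenvalues by (intro Max_ge) auto
  then show ?thesis
    using qform_mono_const[of M c "pverts G" "parcs G" f] M(3)[of f] assms(3) by linarith
qed

text \<open>The elementary half of Perron-Frobenius: scale the positive eigenvector \<open>f\<close>
  until it touches \<open>|g|\<close> from above, and compare neighbour sums at the vertex
  \<open>v\<close> of contact.\<close>

lemma graph_spectral_radius_le:
  assumes fin: "finite (pverts G)" and ne: "pverts G \<noteq> {}" and "sym (parcs G)"
    and pos: "\<And>u. u \<in> pverts G \<Longrightarrow> f u > 0"
    and eig: "\<And>u. u \<in> pverts G \<Longrightarrow> nbr_sum (pverts G) (parcs G) f u = c * f u"
  shows "graph_spectral_radius G \<le> c"
proof -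
  let ?V = "pverts G" and ?E = "parcs G"
  have le: "x \<le> c" if x: "eigenvalue (adjacency_matrix G) x" for x
  proof -
    obtain g where g: "\<exists>u\<in>?V. g u \<noteq> 0" "\<And>u. u \<in> ?V \<Longrightarrow> nbr_sum ?V ?E g u = x * g u"
      using x unfolding eigenvalue_adjacency_matrix_iff[OF fin] by blast
    define r where "r u = \<bar>g u\<bar> / f u" for u
    have "Max (r ` ?V) \<in> r ` ?V" using fin ne by (intro Max_in) auto
    then obtain v where "v \<in> ?V" "r v = Max (r ` ?V)" by auto
    then have v: "v \<in> ?V" "\<And>u. u \<in> ?V \<Longrightarrow> r u \<le> r v" using fin by auto
    have gv: "\<bar>g u\<bar> \<le> r v * f u" if "u \<in> ?V" for u
      using v(2)[OF that] pos[OF that] by (simp add: r_def field_simps)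
    have rv: "r v > 0"
    proof -
      obtain u where "u \<in> ?V" "g u \<noteq> 0" using g(1) by blast
      then have "0 < r u" using pos by (simp add: r_def)
      then show ?thesis using v(2)[OF \<open>u \<in> ?V\<close>] by linarith
    qed
    have "x * \<bar>g v\<bar> \<le> \<bar>x * g v\<bar>" by (simp add: abs_mult mult_right_mono)
    also have "\<dots> = \<bar>nbr_sum ?V ?E g v\<bar>" using g(2)[OF v(1)] by simp
    also have "\<dots> \<le> (\<Sum>u\<in>?V. of_bool ((v, u) \<in> ?E) * \<bar>g u\<bar>)"
      unfolding nbr_sum_def by (rule order_trans[OF sum_abs]) (simp add: abs_mult)
    also have "\<dots> \<le> (\<Sum>u\<in>?V. of_bool ((v, u) \<in> ?E) * (r v * f u))"
      using gv by (intro sum_mono mult_left_mono) auto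
    also have "\<dots> = r v * nbr_sum ?V ?E f v"
      by (simp add: nbr_sum_def sum_distrib_left mult_ac)
    also have "\<dots> = c * (r v * f v)" using eig[OF v(1)] by simp
    also have "r v * f v = \<bar>g v\<bar>" using pos[OF v(1)] by (simp add: r_def)
    finally have "x * \<bar>g v\<bar> \<le> c * \<bar>g v\<bar>" .
    moreover have "\<bar>g v\<bar> > 0" using rv pos[OF v(1)] by (simp add: r_def zero_less_divide_iff)
    ultimately show "x \<le> c" by simp
  qed
  have "eigenvalue (adjacency_matrix G) c"
    unfolding eigenvalue_adjacency_matrix_iff[OF fin]
    using pos eig ne by (metis equals0I less_irrefl)
  then show ?thesis
    unfolding graph_spectral_radius_def
    using le finite_adjacency_eigenvalues by (subst Max_le_iff) auto
qed

section \<open>Positive vectors on an induced subgraph\<close>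

definition pullback :: "nat \<Rightarrow> (nat \<Rightarrow> 'a) \<Rightarrow> 'a rel \<Rightarrow> nat rel" where
  "pullback N h E = {(i, j). i < N \<and> j < N \<and> (h i, h j) \<in> E}"

text \<open>\<open>h\<close> selects vertices of a host graph, and \<open>pullback\<close> keeps
  every host edge between them. A positive vector on the selection, extended by zero, is a test
  vector for the host; \<open>conn\<close> serves the case of equality.\<close>

locale spectral_embedding =
  fixes V :: "'a set" and E :: "'a rel" and c :: real and N :: nat and h :: "nat \<Rightarrow> 'a" and f :: "nat \<Rightarrow> real"
  assumes fin: "finite V" and sym: "sym E" and sub: "E \<subseteq> V \<times> V"
    and conn: "\<And>u v. u \<in> V \<Longrightarrow> v \<in> V \<Longrightarrow> (u, v) \<in> E\<^sup>*"
    and nonpos: "\<And>g. qform V E c g \<le> 0"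
    and inj: "inj_on h {..<N}" and hV: "h ` {..<N} \<subseteq> V" and N: "N > 0"
    and pos: "\<And>i. i < N \<Longrightarrow> f i > 0"
begin

definition lift :: "'a \<Rightarrow> real" where
  "lift v = (if v \<in> h ` {..<N} then f (the_inv_into {..<N} h v) else 0)"

lemma lift_h: "i < N \<Longrightarrow> lift (h i) = f i"
  using inj by (simp add: lift_def the_inv_into_f_f)

lemma lift_eq_0: "v \<notin> h ` {..<N} \<Longrightarrow> lift v = 0"
  by (simp add: lift_def)

lemma lift_nonneg: "lift v \<ge> 0"
  using pos lift_h by (cases "v \<in> h ` {..<N}") (force simp: lift_eq_0)+

lemma sum_lift: "(\<Sum>v\<in>V. k v * lift v) = (\<Sum>i<N. k (h i) * f i)"
proof -
  have "(\<Sum>v\<in>V. k v * lift v) = (\<Sum>v\<in>h ` {..<N}. k v * lift v)"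
    using fin hV by (intro sum.mono_neutral_right) (auto simp: lift_eq_0)
  also have "\<dots> = (\<Sum>i<N. k (h i) * f i)"
    using inj by (simp add: sum.reindex lift_h)
  finally show ?thesis .
qed

lemma nbr_sum_lift: "i < N \<Longrightarrow> nbr_sum V E lift (h i) = nbr_sum {..<N} (pullback N h E) f i"
  unfolding nbr_sum_def sum_lift by (intro sum.cong) (auto simp: pullback_def)

lemma qform_lift: "qform V E c lift = qform {..<N} (pullback N h E) c f"
proof -
  have "qform V E c lift = (\<Sum>v\<in>V. (nbr_sum V E lift v - c * lift v) * lift v)"
    by (simp add: qform_def mult.commute)
  also have "\<dots> = (\<Sum>i<N. (nbr_sum V E lift (h i) - c * lift (h i)) * f i)"
    by (rule sum_lift)
  also have "\<dots> = qform {..<N} (pullback N h E) c f"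
    by (simp add: qform_def nbr_sum_lift lift_h mult.commute)
  finally show ?thesis .
qed

lemma qform_pullback_le_0: "qform {..<N} (pullback N h E) c f \<le> 0"
  using nonpos[of lift] by (simp add: qform_lift)

context
  assumes zero: "qform {..<N} (pullback N h E) c f = 0"
begin

lemma eigen_lift: "u \<in> V \<Longrightarrow> nbr_sum V E lift u = c * lift u"
  using qform_eq_0_imp_eigen[OF fin sym nonpos] zero by (simp add: qform_lift)

lemma eigen_pullback: "i < N \<Longrightarrow> nbr_sum {..<N} (pullback N h E) f i = c * f i"
  using eigen_lift[of "h i"] hV by (simp add: nbr_sum_lift lift_h image_subset_iff)

text \<open>The extension by zero is now an eigenvector. A vertex outside the selection but adjacent
  to it would have entry 0 and a positive neighbour sum, so connectedness leaves no vertex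
  outside.\<close>

lemma spanning: "h ` {..<N} = V"
proof -
  have step: "v \<in> h ` {..<N}" if "u \<in> h ` {..<N}" "(u, v) \<in> E" for u v
  proof (rule ccontr)
    assume v: "v \<notin> h ` {..<N}"
    have vV: "v \<in> V" "(v, u) \<in> E" "u \<in> V" using that sub sym by (auto dest: symD)
    have "lift u > 0" using that(1) pos lift_h by force
    also have "lift u \<le> nbr_sum V E lift v"
      unfolding nbr_sum_def
      using member_le_sum[OF vV(3), of "\<lambda>w. of_bool ((v, w) \<in> E) * lift w"] fin vV lift_nonneg
      by simp
    also have "\<dots> = 0" using eigen_lift[OF vV(1)] lift_eq_0[OF v] by simp
    finally show False by simp
  qed
  have "v \<in> h ` {..<N}" if "v \<in> V" for v
  proof -
    have h0: "h 0 \<in> h ` {..<N}" using N by blast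
    have "(h 0, v) \<in> E\<^sup>*" using conn[of "h 0" v] that h0 hV by blast
    then show ?thesis using h0 by (induction rule: rtrancl_induct) (blast intro: step)+
  qed
  then show ?thesis using hV by blast
qed

end

end

lemma qform_arcs:
  assumes "finite V" "F \<subseteq> V \<times> V"
  shows "qform V F c f = (\<Sum>(u, v)\<in>F. f u * f v) - c * (\<Sum>u\<in>V. (f u)\<^sup>2)"
proof -
  have "(\<Sum>u\<in>V. f u * nbr_sum V F f u) = (\<Sum>(u, v)\<in>V \<times> V. if (u, v) \<in> F then f u * f v else 0)"
    by (auto simp: nbr_sum_def sum_distrib_left sum.cartesian_product of_bool_def mult_ac
        intro!: sum.cong)
  also have "\<dots> = (\<Sum>(u, v)\<in>F. f u * f v)"
    using assms by (intro sum.mono_neutral_cong_right) auto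
  finally show ?thesis
    by (simp add: qform_def right_diff_distrib sum_subtractf sum_distrib_left power2_eq_square mult_ac)
qed

lemma qform_mono_arcs:
  assumes "finite V" "F \<subseteq> F'" "F' \<subseteq> V \<times> V" "\<And>u. u \<in> V \<Longrightarrow> f u \<ge> 0"
  shows "qform V F c f \<le> qform V F' c f"
proof -
  have "(\<Sum>(u, v)\<in>F. f u * f v) \<le> (\<Sum>(u, v)\<in>F'. f u * f v)"
    using assms finite_subset[OF assms(3)] by (intro sum_mono2) (auto intro!: mult_nonneg_nonneg)
  then show ?thesis using assms by (subst (1 2) qform_arcs) auto
qed

lemma qform_add_edge:
  assumes "finite V" "F \<subseteq> F'" "F' \<subseteq> V \<times> V" "\<And>u. u \<in> V \<Longrightarrow> f u \<ge> 0"
    and "sym F'" "sym F" "(a, b) \<in> F' - F" "a \<noteq> b"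
  shows "qform V F c f + 2 * f a * f b \<le> qform V F' c f"
proof -
  let ?F = "insert (a, b) (insert (b, a) F)"
  have ba: "(b, a) \<notin> F" "(b, a) \<in> F'" using assms by (auto dest: symD)
  have F: "finite F" "F \<subseteq> V \<times> V" using assms finite_subset[of F "V \<times> V"] by auto
  have "qform V ?F c f = qform V F c f + 2 * f a * f b"
    using assms ba F by (subst (1 2) qform_arcs) auto
  moreover have "qform V ?F c f \<le> qform V F' c f"
    using assms ba by (intro qform_mono_arcs) auto
  ultimately show ?thesis by simp
qed

section \<open>Cycles and lollipops\<close>

lemma relpow_sym:
  assumes "sym R" "(x, y) \<in> R ^^ n"
  shows "(y, x) \<in> R ^^ n"
  using assms(2)
proof (induction n arbitrary: y)
  case (Suc n)
  then obtain w where "(x, w) \<in> R ^^ n" "(w, y) \<in> R" by auto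
  then have "(y, w) \<in> R" "(w, x) \<in> R ^^ n" using Suc.IH assms(1) by (auto dest: symD)
  then show ?case by (rule relpow_Suc_I2)
qed simp

lemma relpow_segment:
  assumes "\<And>i. i < n \<Longrightarrow> (f i, f (Suc i)) \<in> R" "i \<le> j" "j \<le> n"
  shows "(f i, f j) \<in> R ^^ (j - i)"
  unfolding relpow_fun_conv using assms by (intro exI[of _ "\<lambda>t. f (i + t)"]) auto

text \<open>A periodic enumeration makes the closing edge an ordinary step and turns rotation into a
  shift of the argument.\<close>

definition is_cycle :: "'a rel \<Rightarrow> nat \<Rightarrow> (nat \<Rightarrow> 'a) \<Rightarrow> bool" where
  "is_cycle E m c \<longleftrightarrow> 3 \<le> m \<and> inj_on c {..<m} \<and> (\<forall>i. (c i, c (Suc i)) \<in> E) \<and> (\<forall>i. c (i + m) = c i)"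

lemma is_cycle_mod:
  assumes "is_cycle E m c"
  shows "c (i mod m) = c i"
proof -
  have "c (j + k * m) = c j" for j k
    using assms by (induction k) (auto simp: is_cycle_def add.assoc[symmetric] add.commute[of m])
  from this[of "i mod m" "i div m"] show ?thesis by simp
qed

lemma is_cycle_eq_iff:
  assumes "is_cycle E m c"
  shows "c i = c j \<longleftrightarrow> i mod m = j mod m"
proof -
  have "c i = c j \<longleftrightarrow> c (i mod m) = c (j mod m)" using is_cycle_mod[OF assms] by simp
  also have "\<dots> \<longleftrightarrow> i mod m = j mod m"
    using assms unfolding is_cycle_def by (subst inj_on_eq_iff[where f = c and A = "{..<m}"]) auto
  finally show ?thesis .
qed

lemma is_cycle_range:
  assumes "is_cycle E m c"
  shows "range c = c ` {..<m}"
proof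
  show "range c \<subseteq> c ` {..<m}"
  proof
    fix v assume "v \<in> range c"
    then obtain i where "v = c i" by blast
    then have "v = c (i mod m)" using is_cycle_mod[OF assms] by simp
    moreover have "i mod m < m" using assms by (simp add: is_cycle_def)
    ultimately show "v \<in> c ` {..<m}" by blast
  qed
qed blast

lemma is_cycle_rotate:
  assumes "is_cycle E m c"
  shows "is_cycle E m (\<lambda>i. c (i + r))" "range (\<lambda>i. c (i + r)) = range c"
proof -
  have m: "3 \<le> m" and step: "\<And>i. (c i, c (Suc i)) \<in> E" and per: "\<And>i. c (i + m) = c i"
    using assms by (auto simp: is_cycle_def)
  have "inj_on (\<lambda>i. c (i + r)) {..<m}"
  proof (rule linorder_inj_onI)
    fix i j assume ij: "i < j" "i \<in> {..<m}" "j \<in> {..<m}"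
    then have "\<not> m dvd j + r - (i + r)" by (auto dest: dvd_imp_le)
    then have "(j + r) mod m \<noteq> (i + r) mod m"
      using ij by (subst mod_eq_dvd_iff_nat) auto
    then show "c (i + r) \<noteq> c (j + r)" using is_cycle_eq_iff[OF assms] by metis
  qed auto
  then show rot: "is_cycle E m (\<lambda>i. c (i + r))"
    unfolding is_cycle_def using m step per[of "i + r" for i]
    by (auto simp: add_ac)
  show "range (\<lambda>i. c (i + r)) = range c"
  proof
    show "range c \<subseteq> range (\<lambda>i. c (i + r))"
    proof
      fix v assume "v \<in> range c"
      then obtain i where "v = c i" by blast
      \<comment> \<open>Whole turns make the index large enough to subtract \<open>r\<close> in
        \<open>nat\<close>.\<close>
      also have "c i = c (i + r * m)" using is_cycle_eq_iff[OF assms] by simp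
      also have "i + r * m = (i + r * m - r) + r"
      proof -
        have "r * 1 \<le> r * m" using m by (intro mult_le_mono2) simp
        then show ?thesis by linarith
      qed
      finally show "v \<in> range (\<lambda>i. c (i + r))" by blast
    qed
  qed auto
qed

lemma is_cycle_rotate_to:
  assumes "is_cycle E m c" "v \<in> range c"
  obtains d where "is_cycle E m d" "range d = range c" "d 0 = v"
proof -
  obtain r where "v = c r" using assms(2) by blast
  then show thesis using is_cycle_rotate[OF assms(1), of r] that[of "\<lambda>i. c (i + r)"] by simp
qed

text \<open>A shortest odd closed walk is a cycle, because a repeated vertex would split it into two
  closed walks, one of them odd. If there is no odd closed walk, the parity of walks from a base
  vertex is a proper colouring.\<close>

lemma ex_colouring_or_odd_cycle:
  fixes R :: "'a rel"
  assumes "sym R" and irrefl: "\<And>x. (x, x) \<notin> R"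
  shows "(\<exists>colour :: 'a \<Rightarrow> bool. \<forall>(x, y)\<in>R. colour x \<noteq> colour y) \<or> (\<exists>m c. odd m \<and> is_cycle R m c)"
proof (cases "\<exists>L x. odd L \<and> (x, x) \<in> R ^^ L")
  case True
  define L where "L = (LEAST L. \<exists>x. odd L \<and> (x, x) \<in> R ^^ L)"
  have min: "L \<le> l" if "odd l" "(x, x) \<in> R ^^ l" for l x
    unfolding L_def using that by (intro Least_le) blast
  have "\<exists>x. odd L \<and> (x, x) \<in> R ^^ L" unfolding L_def using LeastI_ex[OF True] .
  then obtain x where L: "odd L" and "(x, x) \<in> R ^^ L" by blast
  then obtain f where f: "f 0 = x" "f L = x" "\<And>i. i < L \<Longrightarrow> (f i, f (Suc i)) \<in> R"
    unfolding relpow_fun_conv by blast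
  have ne: "f i \<noteq> f j" if "i < j" "j < L" for i j
  proof
    assume eq: "f i = f j"
    have 1: "(f j, f j) \<in> R ^^ (j - i)"
      using relpow_segment[of L f R i j, OF f(3)] that eq by simp
    have "(f j, f L) \<in> R ^^ (L - j)" "(f 0, f i) \<in> R ^^ i"
      using relpow_segment[of L f R j L, OF f(3)] relpow_segment[of L f R 0 i, OF f(3)] that by auto
    then have 2: "(f j, f j) \<in> R ^^ (L - j + i)"
      unfolding relpow_add f eq by blast
    show False
    proof (cases "odd (j - i)")
      case True
      then show False using min[OF _ 1] that by simp
    next
      case False
      then have "odd (L - j + i)" using L that by simp
      then show False using min[OF _ 2] that by simp
    qed
  qed
  have "L \<noteq> 1" using f irrefl by (metis One_nat_def less_one)
  moreover obtain k where "L = 2 * k + 1" using L by (rule oddE)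
  ultimately have L3: "3 \<le> L" by simp
  have "(f (i mod L), f (Suc i mod L)) \<in> R" for i
  proof (cases "Suc (i mod L) = L")
    case True
    then have "Suc i mod L = 0" by (simp add: mod_Suc)
    then show ?thesis using f(3)[of "i mod L"] f(1,2) True L3 by simp
  next
    case False
    then have "Suc i mod L = Suc (i mod L)" by (simp add: mod_Suc)
    then show ?thesis using f(3)[of "i mod L"] L3 by simp
  qed
  moreover have "inj_on (\<lambda>i. f (i mod L)) {..<L}"
    using ne by (intro linorder_inj_onI) auto
  ultimately have "is_cycle R L (\<lambda>i. f (i mod L))"
    using L3 by (simp add: is_cycle_def)
  then show ?thesis using L by blast
next
  case False
  \<comment> \<open>Adjacent vertices give \<open>SOME\<close> the same predicate, so
    \<open>rep\<close> is a common base vertex for each component.\<close>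
  define rep where "rep x = (SOME r. (r, x) \<in> R\<^sup>*)" for x
  have rep: "(rep x, x) \<in> R\<^sup>*" for x
    unfolding rep_def by (rule someI[of _ x]) simp
  define colour where "colour x = (\<exists>n. odd n \<and> (rep x, x) \<in> R ^^ n)" for x
  have "colour x \<noteq> colour y" if xy: "(x, y) \<in> R" for x y
  proof
    assume eq: "colour x = colour y"
    have "(r, x) \<in> R\<^sup>* \<longleftrightarrow> (r, y) \<in> R\<^sup>*" for r
      using xy symD[OF assms(1) xy] by (meson rtrancl.rtrancl_into_rtrancl)
    then have r: "rep x = rep y" by (simp add: rep_def)
    show False
    proof (cases "colour x")
      case True
      then obtain a b where "odd a" "odd b" "(rep x, x) \<in> R ^^ a" "(rep y, y) \<in> R ^^ b"
        using eq by (auto simp: colour_def)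
      then have "(rep x, y) \<in> R ^^ Suc a" "(y, rep x) \<in> R ^^ b"
        using xy r relpow_sym[OF assms(1)] by auto
      then have "(rep x, rep x) \<in> R ^^ (Suc a + b)"
        by (simp only: relpow_add) blast
      moreover have "odd (Suc a + b)" using \<open>odd a\<close> \<open>odd b\<close> by simp
      ultimately show False using False by blast
    next
      case no: False
      obtain n where n: "(rep x, x) \<in> R ^^ n" using rep rtrancl_power by blast
      then have "even n" using no by (auto simp: colour_def)
      moreover have "(rep y, y) \<in> R ^^ Suc n" using n xy r by auto
      ultimately have "colour y" unfolding colour_def by (intro exI[of _ "Suc n"]) simp
      then show False using no eq by simp
    qed
  qed
  then show ?thesis by blast
qed

text \<open>A path with a chord at each end. The bounds on \<open>y\<close> and \<open>z\<close>
  keep the chords from being path edges, and \<open>y + 1 < N\<close> makes the path run beyond the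
  cycle that the first chord closes. The order of \<open>y\<close> and \<open>z\<close> is left
  open, so that one notion covers dumbbells, cycles sharing a vertex and theta graphs.\<close>

definition is_lollipop :: "'a rel \<Rightarrow> nat \<Rightarrow> nat \<Rightarrow> nat \<Rightarrow> (nat \<Rightarrow> 'a) \<Rightarrow> bool" where
  "is_lollipop E N y z h \<longleftrightarrow> inj_on h {..<N} \<and> (\<forall>i. Suc i < N \<longrightarrow> (h i, h (Suc i)) \<in> E) \<and>
     2 \<le> y \<and> y + 1 < N \<and> z + 3 \<le> N \<and> (h 0, h y) \<in> E \<and> (h z, h (N - 1)) \<in> E"

text \<open>The path of the lollipop runs around \<open>D\<close> to the attaching vertex
  \<open>D 0\<close> and goes on along \<open>x\<close>. The edge of \<open>D\<close> left out is
  the first chord, the edge from \<open>x r\<close> to \<open>w\<close> the second; \<open>w\<close>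
  differs from \<open>x (r - 1)\<close>, so this is no path edge.\<close>

lemma lollipop_of_cycle_and_path:
  assumes "sym E" and irrefl: "\<And>v. (v, v) \<notin> E"
    and D: "is_cycle E q D" and x0: "x 0 = D 0" and r: "1 \<le> r" and inj: "inj_on x {..r}"
    and out: "\<And>i. 1 \<le> i \<Longrightarrow> i \<le> r \<Longrightarrow> x i \<notin> range D"
    and step: "\<And>i. i < r \<Longrightarrow> (x i, x (Suc i)) \<in> E"
    and w: "w \<in> range D \<union> x ` {..r}" "w \<noteq> x (r - 1)" "(x r, w) \<in> E"
  shows "\<exists>N y z h. is_lollipop E N y z h"
proof -
  have q: "3 \<le> q" and Dinj: "inj_on D {..<q}" and Dstep: "\<And>i. (D i, D (Suc i)) \<in> E"
    and Dper: "D q = D 0"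
    using D by (auto simp: is_cycle_def dest: spec[of _ 0])
  \<comment> \<open>Starting at \<open>D 1\<close> puts \<open>D q = D 0 = x 0\<close> at index
    \<open>q - 1\<close>, where the cycle passes into the path.\<close>
  define h where "h i = (if i < q then D (Suc i) else x (i - (q - 1)))" for i
  define N where "N = q + r"
  have h_x: "h (q - 1 + i) = x i" for i
    using q Dper x0 by (cases i) (auto simp: h_def)
  have inj_h: "inj_on h {..<N}"
  proof (rule linorder_inj_onI)
    fix i j assume ij: "i < j" "i \<in> {..<N}" "j \<in> {..<N}"
    consider "j < q" | "i < q" "q \<le> j" | "q \<le> i" by linarith
    then show "h i \<noteq> h j"
    proof cases
      case 1
      then have "Suc i mod q \<noteq> Suc j mod q"
        using ij by (auto simp: mod_Suc)
      then show ?thesis using is_cycle_eq_iff[OF D] 1 ij by (simp add: h_def)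
    next
      case 2
      then have "h j \<notin> range D" using ij out[of "j - (q - 1)"] by (simp add: h_def N_def)
      then show ?thesis using 2 by (metis h_def rangeI)
    next
      case 3
      then have "i - (q - 1) \<noteq> j - (q - 1)" "i - (q - 1) \<le> r" "j - (q - 1) \<le> r"
        using ij q by (auto simp: N_def)
      then have "x (i - (q - 1)) \<noteq> x (j - (q - 1))" using inj by (auto dest: inj_onD)
      then show ?thesis using 3 ij by (simp add: h_def)
    qed
  qed auto
  have h_step: "(h i, h (Suc i)) \<in> E" if "Suc i < N" for i
  proof (cases "Suc i < q")
    case True
    then show ?thesis using Dstep by (simp add: h_def)
  next
    case False
    obtain k where k: "i = q - 1 + k" using False q that[of "i - (q - 1)"] by simp
    then have "(x k, x (Suc k)) \<in> E" using that q step by (simp add: N_def)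
    then show ?thesis using h_x[of k] h_x[of "Suc k"] k by simp
  qed
  have chord_y: "(h 0, h (q - 1)) \<in> E"
    using Dstep[of 0] q Dper symD[OF assms(1)] by (simp add: h_def)
  have h_last: "h (N - 1) = x r" "h (N - 2) = x (r - 1)"
  proof -
    have "N - 1 = q - 1 + r" "N - 2 = q - 1 + (r - 1)" using q r by (simp_all add: N_def)
    then show "h (N - 1) = x r" "h (N - 2) = x (r - 1)" by (simp_all only: h_x)
  qed
  obtain z where z: "z < N" "h z = w"
  proof (cases "w \<in> range D")
    case True
    then have "w \<in> range (\<lambda>i. D (i + 1))" using is_cycle_rotate(2)[OF D, of 1] by simp
    then have "w \<in> (\<lambda>i. D (i + 1)) ` {..<q}"
      using is_cycle_range[OF is_cycle_rotate(1)[OF D, of 1]] by simp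
    then obtain i where "i < q" "w = D (Suc i)" by auto
    then show thesis using that[of i] by (simp add: h_def N_def)
  next
    case False
    then obtain i where "i \<le> r" "w = x i" using w(1) by auto
    then show thesis using that[of "q - 1 + i"] h_x[of i] q by (simp add: N_def)
  qed
  have "z \<noteq> N - 1" using z h_last w irrefl by auto
  moreover have "z \<noteq> N - 2" using z h_last w by auto
  ultimately have "z + 3 \<le> N" using z by linarith
  moreover have "(h z, h (N - 1)) \<in> E" using z h_last w symD[OF assms(1)] by simp
  ultimately have "is_lollipop E N (q - 1) z h"
    unfolding is_lollipop_def using inj_h h_step chord_y q r by (auto simp: N_def)
  then show ?thesis by blast
qed

text \<open>Follow \<open>C\<close> from a step where it leaves \<open>D\<close> until its first
  return to \<open>D\<close>. This stretch is an ear on \<open>D\<close>, whose two ends may be the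
  same vertex.\<close>

lemma ex_lollipop_meeting_cycles:
  assumes "sym E" and irrefl: "\<And>v. (v, v) \<notin> E"
    and C: "is_cycle E m C" and D: "is_cycle E q D"
    and meet: "range C \<inter> range D \<noteq> {}" and nsub: "\<not> range C \<subseteq> range D"
  shows "\<exists>N y z h. is_lollipop E N y z h"
proof -
  obtain a b where ab: "C a \<in> range D" "C b \<notin> range D" using meet nsub by blast
  have "\<exists>j. C j \<in> range D \<and> C (Suc j) \<notin> range D"
  proof (rule ccontr)
    assume "\<not> ?thesis"
    then have "C (a + t) \<in> range D" for t using ab(1) by (induction t) auto
    moreover have "C b = C (a + (b + a * m - a))"
    proof -
      have "a * 1 \<le> a * m" using C by (intro mult_le_mono2) (simp add: is_cycle_def)
      then have "a + (b + a * m - a) = b + a * m" by linarith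
      then show ?thesis using is_cycle_eq_iff[OF C] by simp
    qed
    ultimately show False using ab(2) by metis
  qed
  then obtain j where j: "C j \<in> range D" "C (Suc j) \<notin> range D" by blast
  define B where "B i = C (i + j)" for i
  have B: "is_cycle E m B" "range B = range C"
    using is_cycle_rotate[OF C, of j] by (simp_all add: B_def[abs_def])
  have B01: "B 0 \<in> range D" "B 1 \<notin> range D" using j by (simp_all add: B_def)
  have m: "3 \<le> m" "B m = B 0" and Binj: "inj_on B {..<m}" and Bstep: "\<And>i. (B i, B (Suc i)) \<in> E"
    using B(1) by (auto simp: is_cycle_def dest: spec[of _ 0])
  obtain F where F: "is_cycle E q F" "range F = range D" "F 0 = B 0"
    using is_cycle_rotate_to[OF D B01(1)] .
  define i where "i = (LEAST i. 0 < i \<and> B i \<in> range D)"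
  have "0 < m \<and> B m \<in> range D" using m B01 by simp
  then have i: "0 < i" "B i \<in> range D" "i \<le> m"
    unfolding i_def by (metis (mono_tags, lifting) LeastI, metis (mono_tags, lifting) LeastI, rule Least_le)
  have before: "B t \<notin> range D" if "0 < t" "t < i" for t
    using not_less_Least[of t "\<lambda>i. 0 < i \<and> B i \<in> range D"] that by (simp add: i_def)
  have i2: "2 \<le> i" using i B01 by (cases "i = 1") auto
  \<comment> \<open>The ear cannot turn straight back: for \<open>i = 2\<close> because a cycle has
    at least three vertices, for larger \<open>i\<close> because \<open>B (i - 2)\<close> is off
    \<open>D\<close>.\<close>
  have ne: "B i \<noteq> B (i - 1 - 1)"
  proof (cases "i = 2")
    case True
    then show ?thesis using Binj m(1) by (auto dest: inj_onD[of _ _ 2 0])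
  next
    case False
    then have "B (i - 1 - 1) \<notin> range D" using i2 by (intro before) auto
    then show ?thesis using i(2) by auto
  qed
  show ?thesis
  proof (rule lollipop_of_cycle_and_path[OF assms(1) irrefl F(1), where w = "B i"])
    show "B 0 = F 0" using F(3) by simp
    show "1 \<le> i - 1" using i2 by simp
    show "inj_on B {..i - 1}" by (rule inj_on_subset[OF Binj]) (use i in auto)
    show "B t \<notin> range F" if "1 \<le> t" "t \<le> i - 1" for t
      unfolding F(2) using that i2 by (intro before) auto
    show "(B t, B (Suc t)) \<in> E" for t by (rule Bstep)
    show "B i \<in> range F \<union> B ` {..i - 1}" using i(2) F(2) by blast
    show "B i \<noteq> B (i - 1 - 1)" by (rule ne)
    show "(B (i - 1), B i) \<in> E" using Bstep[of "i - 1"] i by simp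
  qed
qed

text \<open>A shortest path from \<open>D\<close> to \<open>C\<close> is simple and meets the cycles
  only at its ends. Continue it around \<open>C\<close>; the edge that closes \<open>C\<close> is
  the second chord.\<close>

lemma ex_lollipop_disjoint_cycles:
  assumes "sym E" and irrefl: "\<And>v. (v, v) \<notin> E"
    and C: "is_cycle E m C" and D: "is_cycle E q D"
    and disj: "range C \<inter> range D = {}" and conn: "\<And>u v. u \<in> range D \<Longrightarrow> v \<in> range C \<Longrightarrow> (u, v) \<in> E\<^sup>*"
  shows "\<exists>N y z h. is_lollipop E N y z h"
proof -
  define P where "P n \<longleftrightarrow> (\<exists>u\<in>range D. \<exists>v\<in>range C. (u, v) \<in> E ^^ n)" for n
  define p where "p = (LEAST n. P n)"
  have "\<exists>n. P n" using conn[of "D 0" "C 0"] rtrancl_power[of "(D 0, C 0)" E] by (auto simp: P_def)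
  then have "P p" unfolding p_def by (rule LeastI_ex)
  then obtain x where x: "x 0 \<in> range D" "x p \<in> range C" "\<And>i. i < p \<Longrightarrow> (x i, x (Suc i)) \<in> E"
    unfolding P_def relpow_fun_conv by blast
  have min: "p \<le> n" if "u \<in> range D" "v \<in> range C" "(u, v) \<in> E ^^ n" for u v n
    unfolding p_def using that by (intro Least_le) (auto simp: P_def)
  have p: "1 \<le> p" using x disj by (cases p) auto
  have notD: "x i \<notin> range D" if "1 \<le> i" "i \<le> p" for i
    using min[OF _ x(2) relpow_segment[of p x E i p, OF x(3)]] that by (auto simp: not_le)
  have notC: "x i \<notin> range C" if "i < p" for i
    using min[OF x(1) _ relpow_segment[of p x E 0 i, OF x(3)]] that by auto
  have x_ne: "x i \<noteq> x j" if "i < j" "j \<le> p" for i j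
  proof
    assume eq: "x i = x j"
    have "(x 0, x i) \<in> E ^^ i" "(x j, x p) \<in> E ^^ (p - j)"
      using relpow_segment[of p x E 0 i, OF x(3)] relpow_segment[of p x E j p, OF x(3)] that by auto
    then have "(x 0, x p) \<in> E ^^ (i + (p - j))" unfolding relpow_add eq by blast
    then show False using min[OF x(1,2)] that by fastforce
  qed
  obtain F where F: "is_cycle E q F" "range F = range D" "F 0 = x 0"
    using is_cycle_rotate_to[OF D x(1)] .
  obtain B where B: "is_cycle E m B" "range B = range C" "B 0 = x p"
    using is_cycle_rotate_to[OF C x(2)] .
  have m: "3 \<le> m" "B m = B 0" and Binj: "inj_on B {..<m}" and Bstep: "\<And>i. (B i, B (Suc i)) \<in> E"
    using B(1) by (auto simp: is_cycle_def dest: spec[of _ 0])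
  define w where "w i = (if i \<le> p then x i else B (i - p))" for i
  \<comment> \<open>The walk stops at the last vertex of \<open>C\<close> before the entry vertex
    \<open>w p\<close> would recur.\<close>
  define r where "r = p + m - 1"
  have w_B: "w (p + i) = B i" for i using B(3) by (simp add: w_def)
  have inj_w: "inj_on w {..r}"
  proof (rule linorder_inj_onI)
    fix i j assume ij: "i < j" "i \<in> {..r}" "j \<in> {..r}"
    consider "j \<le> p" | "i < p" "p < j" | "p \<le> i" by linarith
    then show "w i \<noteq> w j"
    proof cases
      case 1
      then show ?thesis using x_ne[of i j] ij by (simp add: w_def)
    next
      case 2
      then show ?thesis using notC[of i] B(2) by (auto simp: w_def)
    next
      case 3
      define k l where "k = i - p" "l = j - p"
      then have "i = p + k" "j = p + l" using 3 ij by auto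
      moreover have "k \<noteq> l" "k < m" "l < m" using 3 ij m by (auto simp: k_l_def r_def)
      ultimately show ?thesis using Binj by (auto simp: w_B dest: inj_onD)
    qed
  qed auto
  have w_step: "(w i, w (Suc i)) \<in> E" for i
  proof (cases "i < p")
    case True
    then show ?thesis using x(3) by (simp add: w_def)
  next
    case False
    then show ?thesis using Bstep[of "i - p"] w_B[of "i - p"] w_B[of "Suc (i - p)"] by simp
  qed
  have end_r: "w r = B (m - 1)" "w (r - 1) = B (m - 2)"
  proof -
    have "r = p + (m - 1)" "r - 1 = p + (m - 2)" using m(1) by (simp_all add: r_def)
    then show "w r = B (m - 1)" "w (r - 1) = B (m - 2)" by (simp_all only: w_B)
  qed
  show ?thesis
  proof (rule lollipop_of_cycle_and_path[OF assms(1) irrefl F(1), where w = "w p"])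
    show "w i \<notin> range F" if "1 \<le> i" for i
    proof (cases "i \<le> p")
      case True
      then show ?thesis using that notD[of i] F(2) by (simp add: w_def)
    next
      case False
      then have "w i \<in> range C" using B(2) by (auto simp: w_def)
      then show ?thesis using F(2) disj by blast
    qed
    show "w p \<in> range F \<union> w ` {..r}" using m by (auto simp: r_def)
    show "w p \<noteq> w (r - 1)"
      unfolding end_r using w_B[of 0] inj_onD[OF Binj, of 0 "m - 2"] m(1) by auto
    show "(w r, w p) \<in> E"
      unfolding end_r using w_B[of 0] Bstep[of "m - 1"] m by simp
    show "w 0 = F 0" using F(3) by (simp add: w_def)
    show "1 \<le> r" using m(1) p by (simp add: r_def)
    show "inj_on w {..r}" by (rule inj_w)
    show "(w i, w (Suc i)) \<in> E" for i by (rule w_step)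
  qed
qed

lemma ex_lollipop:
  assumes "sym E" "\<And>v. (v, v) \<notin> E" "is_cycle E m C" "is_cycle E q D" "\<not> range C \<subseteq> range D"
    and "\<And>u v. u \<in> range D \<Longrightarrow> v \<in> range C \<Longrightarrow> (u, v) \<in> E\<^sup>*"
  shows "\<exists>N y z h. is_lollipop E N y z h"
  using ex_lollipop_meeting_cycles[of E m C q D] ex_lollipop_disjoint_cycles[of E m C q D] assms
  by blast

section \<open>Independent sets and two-colourings\<close>

lemma independence_number_ge:
  assumes "finite (pverts G)" "independent_set G S"
  shows "card S \<le> independence_number G"
proof -
  have "finite {S. independent_set G S}"
    by (rule finite_subset[of _ "Pow (pverts G)"]) (use assms(1) in \<open>auto simp: independent_set_def\<close>)
  then show ?thesis
    unfolding independence_number_def using assms(2) by (intro Max_ge) auto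
qed

lemma independence_number_le:
  assumes "finite (pverts G)" "\<And>S. independent_set G S \<Longrightarrow> card S \<le> a"
  shows "independence_number G \<le> a"
proof -
  have "finite {S. independent_set G S}"
    by (rule finite_subset[of _ "Pow (pverts G)"]) (use assms(1) in \<open>auto simp: independent_set_def\<close>)
  moreover have "independent_set G {}" by (simp add: independent_set_def)
  ultimately show ?thesis
    unfolding independence_number_def using assms(2) by (subst Max_le_iff) auto
qed

text \<open>Both colour classes are independent. In contrapositive form this is the source of odd
  cycles: a set with more than \<open>2 * independence_number G\<close> vertices does not induce a
  bipartite graph.\<close>

lemma card_le_twice_independence_number:
  assumes fin: "finite (pverts G)" and S: "S \<subseteq> pverts G"
    and colour: "\<And>u v. u \<in> S \<Longrightarrow> v \<in> S \<Longrightarrow> (u, v) \<in> parcs G \<Longrightarrow> colour u \<noteq> (colour v :: bool)"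
  shows "card S \<le> 2 * independence_number G"
proof -
  have "independent_set G {u\<in>S. colour u}" "independent_set G {u\<in>S. \<not> colour u}"
    unfolding independent_set_def using S colour by blast+
  from this[THEN independence_number_ge[OF fin]]
  have "card {u\<in>S. colour u} + card {u\<in>S. \<not> colour u} \<le> 2 * independence_number G" by simp
  moreover have "card S = card {u\<in>S. colour u} + card {u\<in>S. \<not> colour u}"
    using finite_subset[OF S fin] by (subst card_Un_disjoint[symmetric]) (auto intro: arg_cong[of _ _ card])
  ultimately show ?thesis by simp
qed

section \<open>Paths with two chords\<close>

text \<open>
  A path \<open>0, ..., N - 1\<close> whose end vertices are joined to \<open>y\<close> and \<open>z\<close>: the dumbbell
  \<open>B(y + 1, z - y, N - z)\<close> if \<open>y < z\<close>, two cycles sharing a vertex if \<open>y = z\<close>, and a theta graph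
  if \<open>z < y\<close>. In each case three arcs (closed or open) meet at \<open>y\<close> and \<open>z\<close>; their lengths are
  \<open>min y z + 1\<close>, \<open>|y - z|\<close> and \<open>N - max y z\<close>.
\<close>

definition chord_arcs :: "nat \<Rightarrow> nat \<Rightarrow> nat \<Rightarrow> nat rel" where
  "chord_arcs N y z = path_arcs 0 (N - 1) \<union> {(0, y), (y, 0), (z, N - 1), (N - 1, z)}"

lemma mem_path_arcs_iff:
  "(i, j) \<in> path_arcs a p \<longleftrightarrow> (a \<le> i \<and> i < a + p \<and> j = Suc i) \<or> (a \<le> j \<and> j < a + p \<and> i = Suc j)"
proof -
  have ex: "(\<exists>t. t < p \<and> i = a + t \<and> j = a + t + 1) \<longleftrightarrow> a \<le> i \<and> i < a + p \<and> j = Suc i" for i j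
  proof
    assume "a \<le> i \<and> i < a + p \<and> j = Suc i"
    then show "\<exists>t. t < p \<and> i = a + t \<and> j = a + t + 1" by (intro exI[of _ "i - a"]) linarith
  qed linarith
  have "(i, j) \<in> path_arcs a p \<longleftrightarrow> (\<exists>t. t < p \<and> i = a + t \<and> j = a + t + 1) \<or> (\<exists>t. t < p \<and> j = a + t \<and> i = a + t + 1)"
    unfolding path_arcs_def by blast
  then show ?thesis unfolding ex .
qed

lemma path_arcs_append: "path_arcs a p \<union> path_arcs (a + p) q = path_arcs a (p + q)"
proof -
  have r: "a \<le> i \<and> i < a + p \<or> a + p \<le> i \<and> i < a + p + q \<longleftrightarrow> a \<le> i \<and> i < a + (p + q)" for i
    by linarith
  have iff: "(i, j) \<in> path_arcs a p \<union> path_arcs (a + p) q \<longleftrightarrow> (i, j) \<in> path_arcs a (p + q)" for i j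
    unfolding Un_iff mem_path_arcs_iff conj_assoc[symmetric] r[symmetric] conj_disj_distribR
    by (simp only: disj_ac)
  show ?thesis by (intro equalityI subrelI) (simp_all only: iff)
qed

lemma mem_chord_arcs_iff:
  "(i, j) \<in> chord_arcs N y z \<longleftrightarrow> (Suc i < N \<and> j = Suc i) \<or> (Suc j < N \<and> i = Suc j) \<or>
     (i = 0 \<and> j = y) \<or> (i = y \<and> j = 0) \<or> (i = z \<and> j = N - 1) \<or> (i = N - 1 \<and> j = z)"
proof -
  have "0 \<le> t \<and> t < 0 + (N - 1) \<longleftrightarrow> Suc t < N" for t by auto
  then show ?thesis
    unfolding chord_arcs_def Un_iff mem_path_arcs_iff insert_iff empty_iff prod.inject by metis
qed

lemma sym_chord_arcs: "sym (chord_arcs N y z)"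
  unfolding sym_def mem_chord_arcs_iff by blast

lemma chord_arcs_subset:
  assumes "y < N" "z < N"
  shows "chord_arcs N y z \<subseteq> {..<N} \<times> {..<N}"
  using assms by (auto simp: mem_chord_arcs_iff)

lemma chord_arcs_subset_pullback:
  assumes "sym E" "is_lollipop E N y z h"
  shows "chord_arcs N y z \<subseteq> pullback N h E"
proof -
  have "\<And>i. Suc i < N \<Longrightarrow> (h i, h (Suc i)) \<in> E \<and> (h (Suc i), h i) \<in> E"
    and "(h 0, h y) \<in> E \<and> (h y, h 0) \<in> E" "(h z, h (N - 1)) \<in> E \<and> (h (N - 1), h z) \<in> E"
    and "y + 1 < N" "z + 3 \<le> N"
    using assms(2) symD[OF assms(1)] by (simp_all add: is_lollipop_def)
  then show ?thesis by (auto simp: mem_chord_arcs_iff pullback_def)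
qed

text \<open>Deleting one vertex leaves a bipartite graph unless the graph is a dumbbell with two odd
  cycles. If \<open>z \<le> y\<close>, deleting \<open>y\<close> destroys every cycle. In a dumbbell
  with an even cycle, parity colours that cycle properly, and deleting the branch vertex of the
  other one suffices.\<close>

lemma chord_arcs_colouring:
  assumes "2 \<le> y" "y + 1 < N" "z + 3 \<le> N" and bad: "\<not> (y < z \<and> even y \<and> even (N - 1 - z))"
  shows "\<exists>v<N. \<exists>colour :: nat \<Rightarrow> bool. \<forall>i j. (i, j) \<in> chord_arcs N y z \<longrightarrow> i \<noteq> v \<longrightarrow> j \<noteq> v \<longrightarrow> colour i \<noteq> colour j"
proof (cases "y < z")
  case False
  obtain M where M: "N = Suc M" using assms by (cases N) auto
  \<comment> \<open>Without \<open>y\<close> the two pieces of the path are joined at most by the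
    chord from \<open>z\<close> to \<open>M\<close>; shifting the parity on the second piece gives
    the ends of this chord different colours.\<close>
  define colour where "colour i = (if i < y then even i else even (i + M + z + 1))" for i
  show ?thesis
    using assms False
    by (intro exI[of _ y] conjI exI[of _ colour] allI impI)
      (auto simp: mem_chord_arcs_iff colour_def M split: if_splits)
next
  case True
  obtain M where M: "N = Suc M" using assms by (cases N) auto
  show ?thesis
  proof (cases "even y")
    case False
    then show ?thesis
      using assms True
      by (intro exI[of _ z] conjI exI[of _ even] allI impI) (auto simp: mem_chord_arcs_iff)
  next
    case ev: True
    then have "odd (M - z)" using True bad M by simp
    then have "odd (M + z)" using assms M by simp
    then show ?thesis
      using assms True
      by (intro exI[of _ y] conjI exI[of _ even] allI impI) (auto simp: mem_chord_arcs_iff M)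
  qed
qed

lemma cycle_arcs_eq:
  assumes "1 \<le> m"
  shows "cycle_arcs a m = path_arcs a (m - 1) \<union> {(a, a + m - 1), (a + m - 1, a)}"
proof -
  have succ: "(\<exists>t. t < m \<and> i = a + t \<and> j = a + (t + 1) mod m) \<longleftrightarrow>
    (a \<le> i \<and> i < a + (m - 1) \<and> j = Suc i) \<or> (i = a + m - 1 \<and> j = a)" (is "?L \<longleftrightarrow> ?R") for i j
  proof
    assume ?L
    then obtain t where t: "t < m" "i = a + t" "j = a + (t + 1) mod m" by blast
    show ?R
    proof (cases "t = m - 1")
      case True
      then show ?thesis using t by simp
    next
      case False
      then show ?thesis using t by simp
    qed
  next
    assume ?R
    then show ?L
    proof
      assume "a \<le> i \<and> i < a + (m - 1) \<and> j = Suc i"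
      then show ?L by (intro exI[of _ "i - a"]) auto
    next
      assume "i = a + m - 1 \<and> j = a"
      then show ?L using assms by (intro exI[of _ "m - 1"]) auto
    qed
  qed
  have "(i, j) \<in> cycle_arcs a m \<longleftrightarrow> (i, j) \<in> path_arcs a (m - 1) \<union> {(a, a + m - 1), (a + m - 1, a)}" for i j
  proof -
    have "(i, j) \<in> cycle_arcs a m \<longleftrightarrow> (\<exists>t. t < m \<and> i = a + t \<and> j = a + (t + 1) mod m) \<or>
        (\<exists>t. t < m \<and> j = a + t \<and> i = a + (t + 1) mod m)"
      unfolding cycle_arcs_def by blast
    then show ?thesis unfolding succ by (auto simp: mem_path_arcs_iff)
  qed
  then show ?thesis by auto
qed

text \<open>The numbering of \<open>B_graph\<close> follows a Hamiltonian path: cycle, path and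
  cycle occupy consecutive runs, and each cycle contributes one further edge, which becomes a
  chord.\<close>

lemma B_graph_eq:
  assumes "1 \<le> m" "1 \<le> q"
  shows "B_graph m p q = \<lparr>pverts = {..<m + p + q - 1}, parcs = chord_arcs (m + p + q - 1) (m - 1) (m - 1 + p)\<rparr>"
proof -
  define N y z where "N = m + p + q - 1" "y = m - 1" "z = m - 1 + p"
  have eq: "0 + m - 1 = y" "z + q - 1 = N - 1" "N - 1 = y + p + (q - 1)" "z = y + p" "m - 1 = y" "m - 1 + p = z"
    using assms by (auto simp: N_y_z_def)
  have "cycle_arcs 0 m \<union> path_arcs y p \<union> cycle_arcs z q =
      (path_arcs 0 y \<union> path_arcs (0 + y) p \<union> path_arcs (0 + (y + p)) (q - 1))
      \<union> {(0, y), (y, 0), (z, N - 1), (N - 1, z)}"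
    unfolding cycle_arcs_eq[OF assms(1)] cycle_arcs_eq[OF assms(2)] eq(1,2,5) unfolding eq(4) add_0
    by (simp add: Un_ac insert_commute Un_insert_left Un_insert_right)
  also have "\<dots> = chord_arcs N y z"
    unfolding path_arcs_append chord_arcs_def eq(3) ..
  finally have *: "cycle_arcs 0 m \<union> path_arcs y p \<union> cycle_arcs z q = chord_arcs N y z" .
  show ?thesis
    by (simp only: B_graph_def *[unfolded N_y_z_def])
qed

text \<open>The bounds make the kinds of adjacency mutually exclusive, so their indicators add up.
  At either end of the path the partner in the chord takes the place of the missing path neighbour,
  the form in which the weights are defined below.\<close>

lemma nbr_sum_chord_arcs:
  assumes "2 \<le> y" "y + 1 < N" "z + 3 \<le> N" "i < N"
  shows "nbr_sum {..<N} (chord_arcs N y z) f i =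
    (if i = 0 then f y else f (i - 1)) + (if i = N - 1 then f z else f (Suc i)) +
    (if i = y then f 0 else 0) + (if i = z then f (N - 1) else 0)"
proof -
  have single: "(\<Sum>j<N. of_bool (P \<and> j = a) * f j) = (if P then f a else 0)" if "P \<longrightarrow> a < N" for P a
    using that by (cases P) (simp_all add: of_bool_def if_distrib[of "\<lambda>x. x * _"] cong: if_cong)
  have "nbr_sum {..<N} (chord_arcs N y z) f i =
    (\<Sum>j<N. of_bool (i > 0 \<and> j = i - 1) * f j + of_bool (i < N - 1 \<and> j = Suc i) * f j
      + of_bool (i = 0 \<and> j = y) * f j + of_bool (i = y \<and> j = 0) * f j
      + of_bool (i = z \<and> j = N - 1) * f j + of_bool (i = N - 1 \<and> j = z) * f j)"
    unfolding nbr_sum_def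
  proof (intro sum.cong refl)
    fix j assume "j \<in> {..<N}"
    then have j: "j < N" by simp
    consider "j = Suc i" | "i = Suc j" | "j \<noteq> Suc i" "i \<noteq> Suc j" by blast
    then show "of_bool ((i, j) \<in> chord_arcs N y z) * f j =
        of_bool (i > 0 \<and> j = i - 1) * f j + of_bool (i < N - 1 \<and> j = Suc i) * f j
        + of_bool (i = 0 \<and> j = y) * f j + of_bool (i = y \<and> j = 0) * f j
        + of_bool (i = z \<and> j = N - 1) * f j + of_bool (i = N - 1 \<and> j = z) * f j"
    proof cases
      case 1
      then have "\<not> (i > 0 \<and> j = i - 1)" "i < N - 1 \<and> j = Suc i" "\<not> (i = 0 \<and> j = y)" "\<not> (i = y \<and> j = 0)"
          "\<not> (i = z \<and> j = N - 1)" "\<not> (i = N - 1 \<and> j = z)" "(i, j) \<in> chord_arcs N y z"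
        using assms j by (auto simp: mem_chord_arcs_iff)
      then show ?thesis by (simp only: simp_thms of_bool_eq mult_zero_left mult_1_left add_0 add_0_right)
    next
      case 2
      then have "i > 0 \<and> j = i - 1" "\<not> (i < N - 1 \<and> j = Suc i)" "\<not> (i = 0 \<and> j = y)" "\<not> (i = y \<and> j = 0)"
          "\<not> (i = z \<and> j = N - 1)" "\<not> (i = N - 1 \<and> j = z)" "(i, j) \<in> chord_arcs N y z"
        using assms j by (auto simp: mem_chord_arcs_iff)
      then show ?thesis by (simp only: simp_thms of_bool_eq mult_zero_left mult_1_left add_0 add_0_right)
    next
      case 3
      have "\<not> (i > 0 \<and> j = i - 1)" using 3 by linarith
      moreover have "(i, j) \<in> chord_arcs N y z \<longleftrightarrow> (i = 0 \<and> j = y) \<or> (i = y \<and> j = 0)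
          \<or> (i = z \<and> j = N - 1) \<or> (i = N - 1 \<and> j = z)"
        using 3 by (simp add: mem_chord_arcs_iff)
      moreover have "y \<noteq> 0" "N - 1 \<noteq> 0" "y \<noteq> N - 1" "z \<noteq> N - 1" using assms by auto
      ultimately show ?thesis using 3 by (simp only: of_bool_def) (auto split: if_splits)
    qed
  qed
  also have "\<dots> = (if i > 0 then f (i - 1) else 0) + (if i < N - 1 then f (Suc i) else 0)
      + (if i = 0 then f y else 0) + (if i = y then f 0 else 0)
      + (if i = z then f (N - 1) else 0) + (if i = N - 1 then f z else 0)"
  proof -
    have "i > 0 \<longrightarrow> i - 1 < N" "i < N - 1 \<longrightarrow> Suc i < N" "i = 0 \<longrightarrow> y < N" "i = y \<longrightarrow> 0 < N"
      "i = z \<longrightarrow> N - 1 < N" "i = N - 1 \<longrightarrow> z < N" using assms by auto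
    from this[THEN single] show ?thesis unfolding sum.distrib by (simp only:)
  qed
  also have "\<dots> = ((if i > 0 then f (i - 1) else 0) + (if i = 0 then f y else 0))
      + ((if i < N - 1 then f (Suc i) else 0) + (if i = N - 1 then f z else 0))
      + (if i = y then f 0 else 0) + (if i = z then f (N - 1) else 0)" by simp
  also have "(if i > 0 then f (i - 1) else 0) + (if i = 0 then f y else 0) = (if i = 0 then f y else f (i - 1))"
    by simp
  also have "(if i < N - 1 then f (Suc i) else 0) + (if i = N - 1 then f z else 0) =
      (if i = N - 1 then f z else f (Suc i))" using assms(4) by (cases "i = N - 1") auto
  finally show ?thesis .
qed

text \<open>
  The solution of \<open>x (i - 1) + x (i + 1) = 2 cosh (2 s) x i\<close> on an arc with \<open>l\<close> edges that takes the
  value 1 at both ends.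
\<close>

definition arc_weight :: "real \<Rightarrow> nat \<Rightarrow> nat \<Rightarrow> real" where
  "arc_weight s l i = cosh ((real l - 2 * real i) * s) / cosh (real l * s)"

lemma arc_weight_pos: "arc_weight s l i > 0"
  by (simp add: arc_weight_def)

lemma arc_weight_ge: "arc_weight s l i \<ge> 1 / cosh (real l * s)"
  unfolding arc_weight_def by (intro divide_right_mono) (auto simp: cosh_real_ge_1)

lemma arc_weight_0 [simp]: "arc_weight s l 0 = 1"
  by (simp add: arc_weight_def)

lemma arc_weight_flip: "i \<le> l \<Longrightarrow> arc_weight s l (l - i) = arc_weight s l i"
proof -
  assume "i \<le> l"
  then have "(real l - 2 * real (l - i)) * s = - ((real l - 2 * real i) * s)"
    by (simp add: algebra_simps of_nat_diff)
  then show ?thesis unfolding arc_weight_def by (simp only: cosh_minus)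
qed

lemma arc_weight_end [simp]: "arc_weight s l l = 1"
  using arc_weight_flip[of 0 l s] by simp

text \<open>The origin of the \<open>tanh\<close> terms: this is what an arc contributes to the
  neighbour sum at its end. For \<open>l = 0\<close> it is \<open>cosh (2 * s)\<close>.\<close>

lemma arc_weight_1: "arc_weight s l 1 = cosh (2 * s) - sinh (2 * s) * tanh (real l * s)"
proof -
  have "cosh ((real l - 2) * s) = cosh (real l * s) * cosh (2 * s) - sinh (real l * s) * sinh (2 * s)"
    by (simp add: left_diff_distrib cosh_diff)
  then show ?thesis
    by (simp add: arc_weight_def tanh_def diff_divide_distrib)
qed

lemma arc_weight_step:
  "arc_weight s l i + arc_weight s l (i + 2) = 2 * cosh (2 * s) * arc_weight s l (i + 1)"
proof -
  define x where "x = (real l - 2 * real (i + 1)) * s"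
  have "(real l - 2 * real i) * s = x + 2 * s" "(real l - 2 * real (i + 2)) * s = x - 2 * s"
    by (simp_all add: x_def algebra_simps)
  then show ?thesis
    unfolding arc_weight_def x_def[symmetric]
    by (simp add: cosh_add cosh_diff add_divide_distrib[symmetric])
qed

text \<open>
  Here the path is extended by copies \<open>0\<close> and \<open>a + b + c\<close> of the branch vertices that the ends of
  the path are joined to, which shifts the vertices by one.
\<close>

definition chord_weight :: "real \<Rightarrow> nat \<Rightarrow> nat \<Rightarrow> nat \<Rightarrow> nat \<Rightarrow> real" where
  "chord_weight s a b c j =
     (if j \<le> a then arc_weight s a j else if j \<le> a + b then arc_weight s b (j - a)
      else arc_weight s c (j - (a + b)))"

lemma chord_weight_seg1: "j \<le> a \<Longrightarrow> chord_weight s a b c j = arc_weight s a j"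
  by (simp add: chord_weight_def)

lemma chord_weight_seg2: "j \<le> b \<Longrightarrow> chord_weight s a b c (a + j) = arc_weight s b j"
  by (cases j) (simp_all add: chord_weight_def)

lemma chord_weight_seg3: "chord_weight s a b c (a + b + j) = arc_weight s c j"
proof (cases j)
  case 0
  then show ?thesis using chord_weight_seg2[of b b s a c] by simp
qed (simp add: chord_weight_def)

lemma chord_weight_pos: "chord_weight s a b c j > 0"
  by (simp add: chord_weight_def arc_weight_pos)

lemma chord_weight_step:
  assumes "j + 1 \<noteq> a" "j + 1 \<noteq> a + b"
  shows "chord_weight s a b c j + chord_weight s a b c (j + 2) = 2 * cosh (2 * s) * chord_weight s a b c (j + 1)"
proof -
  consider "j + 2 \<le> a" | "a \<le> j" "j + 2 \<le> a + b" | "a + b \<le> j" using assms by linarith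
  then show ?thesis
  proof cases
    case 1
    then show ?thesis using arc_weight_step[of s a j] by (simp add: chord_weight_seg1)
  next
    case 2
    then obtain t where "j = a + t" using le_Suc_ex by blast
    then show ?thesis
      using 2 arc_weight_step[of s b t] chord_weight_seg2[of t b s a c]
        chord_weight_seg2[of "t + 1" b s a c] chord_weight_seg2[of "t + 2" b s a c]
      by (simp add: add.assoc)
  next
    case 3
    then obtain t where "j = a + b + t" using le_Suc_ex by blast
    then show ?thesis
      using arc_weight_step[of s c t] chord_weight_seg3[of s a b c t]
        chord_weight_seg3[of s a b c "t + 1"] chord_weight_seg3[of s a b c "t + 2"]
      by (simp add: add.assoc)
  qed
qed

section \<open>The weight vector on a path with two chords\<close>

locale chord_model =
  fixes N y z :: nat and s :: real
  assumes bounds: "2 \<le> y" "y + 1 < N" "z + 3 \<le> N"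
begin

definition a where "a = min y z + 1"
definition b where "b = max y z - min y z"
definition c where "c = N - max y z"

definition w where "w i = chord_weight s a b c (i + 1)"

lemma abc: "a \<ge> 1" "c \<ge> 2" "a + b + c = N + 1"
  using bounds by (auto simp: a_def b_def c_def)

lemma w_pos: "w i > 0"
  by (simp add: w_def chord_weight_pos)

lemma w_yz: "w y = 1" "w z = 1"
proof -
  have "y + 1 = a \<or> y + 1 = a + b" "z + 1 = a \<or> z + 1 = a + b" by (auto simp: a_def b_def)
  then show "w y = 1" "w z = 1"
    using chord_weight_seg1[of a a s b c] chord_weight_seg2[of b b s a c] by (auto simp: w_def)
qed

lemma w_ends: "w 0 = arc_weight s a 1" "w (N - 1) = arc_weight s c 1"
proof -
  show "w 0 = arc_weight s a 1" using abc by (simp add: w_def chord_weight_seg1)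
  have "N - 1 + 1 = a + b + (c - 1)" using abc by simp
  then have "w (N - 1) = arc_weight s c (c - 1)"
    unfolding w_def by (simp only: chord_weight_seg3)
  then show "w (N - 1) = arc_weight s c 1" using abc by (simp add: arc_weight_flip)
qed

text \<open>The residual of the eigenvector equation; only the branch vertices \<open>y\<close> and
  \<open>z\<close> can have a nonzero one.\<close>

definition defect where
  "defect i = nbr_sum {..<N} (chord_arcs N y z) w i - 2 * cosh (2 * s) * w i"

text \<open>The copies at positions 0 and \<open>a + b + c\<close> have value 1, like
  \<open>w y\<close> and \<open>w z\<close>, so the ends of the path need no separate
  treatment.\<close>

lemma defect_eq:
  assumes "i < N"
  shows "defect i = chord_weight s a b c i + chord_weight s a b c (i + 2)
     - 2 * cosh (2 * s) * chord_weight s a b c (i + 1)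
     + (if i = y then arc_weight s a 1 else 0) + (if i = z then arc_weight s c 1 else 0)"
proof -
  have "(if i = 0 then w y else w (i - 1)) = chord_weight s a b c i"
    using w_yz(1) by (auto simp: w_def chord_weight_seg1)
  moreover have "(if i = N - 1 then w z else w (Suc i)) = chord_weight s a b c (i + 2)"
  proof (cases "i = N - 1")
    case True
    then have "i + 2 = a + b + c" using abc by simp
    then show ?thesis using True w_yz(2) chord_weight_seg3[of s a b c c] by simp
  qed (simp add: w_def)
  ultimately show ?thesis
    unfolding defect_def nbr_sum_chord_arcs[OF bounds assms] w_ends
    by (simp only: w_def[of i])
qed

lemma defect_0:
  assumes "i < N" "i \<noteq> y" "i \<noteq> z"
  shows "defect i = 0"
proof -
  have "i + 1 \<noteq> a" "i + 1 \<noteq> a + b" using assms by (auto simp: a_def b_def min_def max_def)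
  from chord_weight_step[OF this] show ?thesis using defect_eq[OF assms(1)] assms by simp
qed

lemma chord_weight_near:
  "chord_weight s a b c (a - 1) = arc_weight s a 1"
  "b \<ge> 1 \<Longrightarrow> chord_weight s a b c (a + 1) = arc_weight s b 1"
  "b \<ge> 1 \<Longrightarrow> chord_weight s a b c (a + b - 1) = arc_weight s b 1"
  "chord_weight s a b c (a + b + 1) = arc_weight s c 1"
proof -
  show "chord_weight s a b c (a - 1) = arc_weight s a 1"
    using abc by (simp add: chord_weight_seg1 arc_weight_flip)
  show "chord_weight s a b c (a + b + 1) = arc_weight s c 1" by (rule chord_weight_seg3)
  assume b: "b \<ge> 1"
  show "chord_weight s a b c (a + 1) = arc_weight s b 1"
    using b by (simp only: chord_weight_seg2)
  have "chord_weight s a b c (a + (b - 1)) = arc_weight s b (b - 1)"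
    by (rule chord_weight_seg2) simp
  then show "chord_weight s a b c (a + b - 1) = arc_weight s b 1"
    using b by (simp add: arc_weight_flip)
qed

lemma defect_dumbbell:
  assumes "y < z"
  shows "defect y = 2 * arc_weight s a 1 + arc_weight s b 1 - 2 * cosh (2 * s)"
    and "defect z = arc_weight s b 1 + 2 * arc_weight s c 1 - 2 * cosh (2 * s)"
proof -
  have y: "y = a - 1" "y + 2 = a + 1" "y + 1 = a" "b \<ge> 1" "y < N"
    and z: "z = a + b - 1" "z + 2 = a + b + 1" "z + 1 = a + b" "z < N"
    unfolding a_def b_def using assms bounds by auto
  note near = chord_weight_near(1) chord_weight_near(2,3)[OF y(4)] chord_weight_near(4)
  have "w y = chord_weight s a b c a" using y by (simp only: w_def)
  then have 1: "chord_weight s a b c a = 1" using w_yz by simp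
  have "w z = chord_weight s a b c (a + b)" using z by (simp only: w_def)
  then have 2: "chord_weight s a b c (a + b) = 1" using w_yz by simp
  show "defect y = 2 * arc_weight s a 1 + arc_weight s b 1 - 2 * cosh (2 * s)"
    unfolding defect_eq[OF y(5)] y(2,3) near 1 using assms near(1) y(1) by simp
  show "defect z = arc_weight s b 1 + 2 * arc_weight s c 1 - 2 * cosh (2 * s)"
    unfolding defect_eq[OF z(4)] z(2,3) near 2 using assms near(3) z(1) by simp
qed

lemma defect_theta:
  assumes "z < y" and "v = y \<or> v = z"
  shows "defect v = arc_weight s a 1 + arc_weight s b 1 + arc_weight s c 1 - 2 * cosh (2 * s)"
proof -
  have z: "z = a - 1" "z + 2 = a + 1" "z + 1 = a" "b \<ge> 1" "z < N"
    and y: "y = a + b - 1" "y + 2 = a + b + 1" "y + 1 = a + b" "y < N"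
    unfolding a_def b_def using assms bounds by auto
  note near = chord_weight_near(1) chord_weight_near(2,3)[OF z(4)] chord_weight_near(4)
  have "w z = chord_weight s a b c a" using z by (simp only: w_def)
  then have 1: "chord_weight s a b c a = 1" using w_yz by simp
  have "w y = chord_weight s a b c (a + b)" using y by (simp only: w_def)
  then have 2: "chord_weight s a b c (a + b) = 1" using w_yz by simp
  have "defect z = arc_weight s a 1 + arc_weight s b 1 + arc_weight s c 1 - 2 * cosh (2 * s)"
    unfolding defect_eq[OF z(5)] z(2,3) near 1 using assms near(1) z(1) by simp
  moreover have "defect y = arc_weight s a 1 + arc_weight s b 1 + arc_weight s c 1 - 2 * cosh (2 * s)"
    unfolding defect_eq[OF y(4)] y(2,3) near 2 using assms near(3) y(1) by simp
  ultimately show ?thesis using assms by blast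
qed

lemma defect_infinity:
  assumes "z = y"
  shows "defect y = 2 * arc_weight s a 1 + 2 * arc_weight s c 1 - 2 * cosh (2 * s)"
proof -
  have y: "y = a - 1" "y + 2 = a + b + 1" "y + 1 = a" "y < N" "b = 0"
    unfolding a_def b_def using assms bounds by auto
  have "w y = chord_weight s a b c a" using y by (simp only: w_def)
  then have 1: "chord_weight s a b c a = 1" using w_yz by simp
  show ?thesis
    unfolding defect_eq[OF y(4)] y(2,3) chord_weight_near 1
    using assms chord_weight_near(1) y(1) by simp
qed

text \<open>The value does not depend on how the three arcs are attached.\<close>

lemma qform_chord_arcs:
  "qform {..<N} (chord_arcs N y z) (2 * cosh (2 * s)) w =
   2 * (cosh (2 * s) - sinh (2 * s) * (tanh (real a * s) + tanh (real b * s) + tanh (real c * s)))"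
proof -
  have yz: "y < N" "z < N" using bounds by auto
  have "qform {..<N} (chord_arcs N y z) (2 * cosh (2 * s)) w = (\<Sum>i<N. w i * defect i)"
    by (simp add: qform_def defect_def)
  also have "\<dots> = (\<Sum>i\<in>{y, z}. w i * defect i)"
    using yz defect_0 by (intro sum.mono_neutral_right) auto
  also have "\<dots> = (\<Sum>i\<in>{y, z}. defect i)"
    using w_yz by (intro sum.cong) auto
  also have "\<dots> = 2 * (arc_weight s a 1 + arc_weight s b 1 + arc_weight s c 1 - 2 * cosh (2 * s))"
  proof -
    consider "y < z" | "z < y" | "z = y" by linarith
    then show ?thesis
    proof cases
      case 1
      then show ?thesis using defect_dumbbell by simp
    next
      case 2
      then show ?thesis using defect_theta by simp
    next
      case 3
      \<comment> \<open>The arc of length 0 contributes just what compensates for the merging of the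
        two branch vertices, where \<open>2 * cosh (2 * s)\<close> is subtracted once instead of
        twice.\<close>
      have "arc_weight s b 1 = cosh (2 * s)"
        using 3 arc_weight_1[of s 0] unfolding b_def by simp
      moreover have "{y, z} = {y}" using 3 by blast
      ultimately show ?thesis using defect_infinity[OF 3] by simp
    qed
  qed
  also have "\<dots> = 2 * (cosh (2 * s) - sinh (2 * s) * (tanh (real a * s) + tanh (real b * s) + tanh (real c * s)))"
    unfolding arc_weight_1 by (simp add: algebra_simps)
  finally show ?thesis .
qed

end

section \<open>Sums of hyperbolic tangents\<close>

locale concave_sequence =
  fixes F :: "nat \<Rightarrow> real"
  assumes incr: "F i < F (Suc i)"
    and concave: "F i + F (i + 2) < 2 * F (i + 1)"
begin

definition slope where "slope i = F (Suc i) - F i"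

lemma slope_pos: "slope i > 0"
  using incr by (simp add: slope_def)

lemma slope_less: "i < j \<Longrightarrow> slope j < slope i"
proof (rule lift_Suc_mono_less[of "\<lambda>i. - slope i", simplified])
  show "slope (Suc n) < slope n" for n
    using concave[of n] by (simp add: slope_def)
qed

text \<open>The distance of \<open>F\<close> from its secant through \<open>j\<close> and \<open>j + 1\<close>.\<close>

definition gap where "gap j l = F j + slope j * (real l - real j) - F l"

lemma gap_Suc: "gap j (Suc l) = gap j l + (slope j - slope l)"
  by (simp add: gap_def slope_def algebra_simps)

lemma gap_self [simp]: "gap j j = 0" "gap j (Suc j) = 0"
  by (simp_all add: gap_def slope_def)

lemma gap_right_less: "l < l' \<Longrightarrow> Suc j \<le> l \<Longrightarrow> gap j l < gap j l'"
proof (induction rule: less_Suc_induct)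
  case (1 i)
  then show ?case using slope_less[of j i] gap_Suc[of j i] by linarith
qed auto

lemma gap_left_less: "l < l' \<Longrightarrow> l' \<le> j \<Longrightarrow> gap j l' < gap j l"
proof (induction rule: less_Suc_induct)
  case (1 i)
  then show ?case using slope_less[of i j] gap_Suc[of j i] by linarith
qed auto

lemma gap_pos: "l \<noteq> j \<Longrightarrow> l \<noteq> Suc j \<Longrightarrow> gap j l > 0"
  using gap_right_less[of "Suc j" l j] gap_left_less[of l j j] by fastforce

lemma gap_nonneg: "gap j l \<ge> 0"
  using gap_pos[of l j] by (cases "l = j \<or> l = Suc j") auto

text \<open>The secant part depends only on the total length, so triples are compared through their
  totals and their gaps.\<close>

lemma sum3_eq:
  "F a + F b + F c = 3 * F j + slope j * (real (a + b + c) - 3 * real j) - (gap j a + gap j b + gap j c)"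
  by (simp add: gap_def algebra_simps)

text \<open>The secant part exceeds \<open>3 * F k\<close> by nothing, so all gaps vanish. Each
  length is then \<open>k\<close> or \<open>k + 1\<close>, and the total decides.\<close>

lemma sum3_max_0:
  assumes "a + b + c \<le> 3 * k" "F a + F b + F c \<ge> 3 * F k"
  shows "a = k \<and> b = k \<and> c = k"
proof -
  have g: "gap k a \<ge> 0" "gap k b \<ge> 0" "gap k c \<ge> 0" by (rule gap_nonneg)+
  have "slope k * (real (a + b + c) - 3 * real k) \<le> slope k * 0"
    using assms(1) slope_pos[of k] by (intro mult_left_mono) linarith+
  then have g0: "gap k a + gap k b + gap k c \<le> slope k * (real (a + b + c) - 3 * real k)"
      "slope k * (real (a + b + c) - 3 * real k) \<le> 0"
    using assms(2) sum3_eq[of a b c k] by auto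
  then have "gap k a = 0" "gap k b = 0" "gap k c = 0" "slope k * (real (a + b + c) - 3 * real k) = 0"
    using g by linarith+
  then have "a = k \<or> a = Suc k" "b = k \<or> b = Suc k" "c = k \<or> c = Suc k" "a + b + c = 3 * k"
    using gap_pos[of a k] gap_pos[of b k] gap_pos[of c k] slope_pos[of k] by force+
  then show ?thesis by linarith
qed

text \<open>The bound is the value of the odd triple, not the maximum. A smaller total misses it by
  at least \<open>slope (j + 1)\<close>. With the full total the gaps may add up to
  \<open>gap j (j + 2)\<close>: no length exceeds \<open>j + 2\<close>, and a length
  \<open>j + 2\<close> uses up the allowance and leaves \<open>j\<close> for the others.\<close>

lemma sum3_max_2:
  assumes le: "a + b + c \<le> 3 * j + 2" and ge: "F a + F b + F c \<ge> 2 * F j + F (j + 2)"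
  shows "(a, b, c) \<in> {(j, j+1, j+1), (j+1, j, j+1), (j+1, j+1, j), (j, j, j+2), (j, j+2, j), (j+2, j, j)}"
proof -
  have g: "gap j a \<ge> 0" "gap j b \<ge> 0" "gap j c \<ge> 0" by (rule gap_nonneg)+
  have g2: "gap j (j + 2) = slope j - slope (j + 1)"
    using gap_Suc[of j "Suc j"] by simp
  have tgt: "2 * F j + F (j + 2) = 3 * F j + 2 * slope j - gap j (j + 2)"
    by (simp add: gap_def)
  have tot: "a + b + c = 3 * j + 2"
  proof (rule ccontr)
    assume "a + b + c \<noteq> 3 * j + 2"
    then have "real (a + b + c) - 3 * real j \<le> 1" using le by linarith
    then have "slope j * (real (a + b + c) - 3 * real j) \<le> slope j * 1"
      using slope_pos[of j] by (intro mult_left_mono) auto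
    then show False using ge tgt g g2 sum3_eq[of a b c j] slope_pos[of "j + 1"] by linarith
  qed
  then have "real (a + b + c) - 3 * real j = 2" by linarith
  then have sum: "gap j a + gap j b + gap j c \<le> gap j (j + 2)"
    using ge tgt sum3_eq[of a b c j] by simp
  have big: "l \<le> j + 2" if "gap j l \<le> gap j (j + 2)" for l
    using gap_right_less[of "j + 2" l j] that by fastforce
  have "a \<le> j + 2" "b \<le> j + 2" "c \<le> j + 2" using big g sum by auto
  moreover have zero: "l = j \<or> l = Suc j" if "gap j l \<le> 0" for l using gap_pos[of l j] that by force
  have "a = j + 2 \<Longrightarrow> b = j \<and> c = j" using zero[of b] zero[of c] sum g tot by force
  moreover have "b = j + 2 \<Longrightarrow> a = j \<and> c = j" using zero[of a] zero[of c] sum g tot by force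
  moreover have "c = j + 2 \<Longrightarrow> a = j \<and> b = j" using zero[of a] zero[of b] sum g tot by force
  moreover have "a = j \<and> b = j + 1 \<and> c = j + 1 \<or> b = j \<and> a = j + 1 \<and> c = j + 1 \<or> c = j \<and> a = j + 1 \<and> b = j + 1"
    if "a \<le> j + 1" "b \<le> j + 1" "c \<le> j + 1"
    using tot that by linarith
  moreover have "l = j + 2 \<or> l \<le> j + 1" if "l \<le> j + 2" for l using that by linarith
  ultimately show ?thesis unfolding insert_iff prod.inject by metis
qed

text \<open>The mirror image, with the short length \<open>i\<close> below the secant through
  \<open>i + 1\<close> and \<open>i + 2\<close>. Here \<open>slope2\<close> says that
  \<open>gap j i < slope j\<close> for \<open>j = i + 1\<close>, so losing a unit of total length
  costs more than the allowance for gaps.\<close>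

lemma sum3_max_1:
  assumes le: "a + b + c \<le> 3 * i + 4" and ge: "F a + F b + F c \<ge> F i + 2 * F (i + 2)"
    and slope2: "slope i < 2 * slope (i + 1)"
  shows "(a, b, c) \<in> {(i+1, i+1, i+2), (i+1, i+2, i+1), (i+2, i+1, i+1), (i, i+2, i+2), (i+2, i, i+2), (i+2, i+2, i)}"
proof -
  define j where "j = i + 1"
  have g: "gap j a \<ge> 0" "gap j b \<ge> 0" "gap j c \<ge> 0" by (rule gap_nonneg)+
  have g2: "gap j i = slope i - slope j"
    using gap_Suc[of j i] by (simp add: j_def)
  have tgt: "F i + 2 * F (i + 2) = 3 * F j + slope j - gap j i"
    by (simp add: gap_def slope_def j_def)
  have tot: "a + b + c = 3 * j + 1"
  proof (rule ccontr)
    assume "a + b + c \<noteq> 3 * j + 1"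
    then have "a + b + c \<le> 3 * j" using le unfolding j_def by arith
    then have "real (a + b + c) \<le> real (3 * j)" by (simp only: of_nat_le_iff)
    then have "real (a + b + c) - 3 * real j \<le> 0" by simp
    then have "slope j * (real (a + b + c) - 3 * real j) \<le> slope j * 0"
      using slope_pos[of j] by (intro mult_left_mono) auto
    then show False using ge tgt g g2 sum3_eq[of a b c j] slope2 by (simp add: j_def)
  qed
  then have "real (a + b + c) - 3 * real j = 1" by linarith
  then have sum: "gap j a + gap j b + gap j c \<le> gap j i"
    using ge tgt sum3_eq[of a b c j] by simp
  have big: "i \<le> l" if "gap j l \<le> gap j i" for l
    using gap_left_less[of l i j] that unfolding j_def by fastforce
  have "i \<le> a" "i \<le> b" "i \<le> c" using big g sum by auto
  moreover have zero: "l = j \<or> l = Suc j" if "gap j l \<le> 0" for l using gap_pos[of l j] that by force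
  have "a = i \<Longrightarrow> b = i + 2 \<and> c = i + 2" using zero[of b] zero[of c] sum g tot unfolding j_def by force
  moreover have "b = i \<Longrightarrow> a = i + 2 \<and> c = i + 2" using zero[of a] zero[of c] sum g tot unfolding j_def by force
  moreover have "c = i \<Longrightarrow> a = i + 2 \<and> b = i + 2" using zero[of a] zero[of b] sum g tot unfolding j_def by force
  moreover have "a = i + 1 \<and> b = i + 1 \<and> c = i + 2 \<or> a = i + 1 \<and> b = i + 2 \<and> c = i + 1 \<or> a = i + 2 \<and> b = i + 1 \<and> c = i + 1"
    if ge: "i + 1 \<le> a" "i + 1 \<le> b" "i + 1 \<le> c"
  proof -
    obtain u v w where "a = i + 1 + u" "b = i + 1 + v" "c = i + 1 + w"
      using ge[THEN le_Suc_ex] by blast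
    moreover from this have "u + v + w = 1" using tot unfolding j_def by arith
    ultimately show ?thesis by (auto simp: add_is_1)
  qed
  moreover have "l = i \<or> i + 1 \<le> l" if "i \<le> l" for l using that by linarith
  ultimately show ?thesis unfolding insert_iff prod.inject by metis
qed

end

text \<open>An exact formula, because it serves twice: its sign gives strict concavity, and its size
  is weighed against an additional edge.\<close>

lemma tanh_second_difference:
  fixes x s :: real
  shows "2 * tanh x - tanh (x - s) - tanh (x + s) =
    2 * (sinh s)\<^sup>2 * sinh x / (cosh x * (cosh (x - s) * cosh (x + s)))"
proof -
  have c: "cosh x > 0" "cosh (x - s) > 0" "cosh (x + s) > 0" by simp_all
  have "sinh (x - s) * cosh (x + s) + sinh (x + s) * cosh (x - s) = sinh ((x - s) + (x + s))"
    unfolding sinh_add[of "x - s" "x + s"] by simp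
  also have "(x - s) + (x + s) = 2 * x" by simp
  also have "sinh (2 * x) = 2 * sinh x * cosh x" by (rule sinh_double)
  finally have num: "sinh (x - s) * cosh (x + s) + sinh (x + s) * cosh (x - s) = 2 * sinh x * cosh x" .
  have P: "cosh (x - s) * cosh (x + s) = (cosh x)\<^sup>2 + (sinh s)\<^sup>2"
  proof -
    have "cosh (x - s) * cosh (x + s) = (cosh x)\<^sup>2 * (cosh s)\<^sup>2 - (sinh x)\<^sup>2 * (sinh s)\<^sup>2"
      by (simp add: cosh_add cosh_diff power2_eq_square algebra_simps)
    then show ?thesis by (simp add: sinh_square_eq algebra_simps)
  qed
  have frac: "2 * S / C - 2 * S * C / Q = 2 * S * (Q - C\<^sup>2) / (C * Q)" if "C \<noteq> 0" "Q \<noteq> 0" for S C Q :: real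
    using that by (simp add: field_simps power2_eq_square)
  have "2 * tanh x - tanh (x - s) - tanh (x + s) =
      2 * sinh x / cosh x - (sinh (x - s) * cosh (x + s) + sinh (x + s) * cosh (x - s)) / (cosh (x - s) * cosh (x + s))"
    using c by (simp add: tanh_def add_divide_distrib)
  also have "\<dots> = 2 * sinh x * (cosh (x - s) * cosh (x + s) - (cosh x)\<^sup>2) / (cosh x * (cosh (x - s) * cosh (x + s)))"
    unfolding num using c by (intro frac) simp_all
  also have "cosh (x - s) * cosh (x + s) - (cosh x)\<^sup>2 = (sinh s)\<^sup>2" unfolding P by simp
  finally show ?thesis by (simp add: mult_ac)
qed

lemma tanh_diff_eq:
  fixes x y :: real
  shows "tanh x - tanh y = sinh (x - y) / (cosh x * cosh y)"
proof -
  have "cosh x > 0" "cosh y > 0" by simp_all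
  then show ?thesis by (simp add: tanh_def sinh_diff field_simps)
qed

lemma cosh_add_le_exp:
  fixes x t :: real
  assumes "t \<ge> 0"
  shows "cosh (x + t) \<le> exp t * cosh x"
proof -
  have "sinh x * sinh t \<le> cosh x * sinh t"
    using assms by (intro mult_right_mono) (auto simp: sinh_le_cosh_real)
  then have "cosh (x + t) \<le> cosh x * (cosh t + sinh t)"
    by (simp add: cosh_add algebra_simps)
  also have "cosh t + sinh t = exp t" by (rule cosh_plus_sinh)
  finally show ?thesis by (simp add: mult.commute)
qed

context
  fixes s :: real
  assumes s: "s > 0"
begin

lemma concave_sequence_tanh: "concave_sequence (\<lambda>l. tanh (real l * s))"
proof
  show "tanh (real i * s) < tanh (real (Suc i) * s)" for i
    using s by (simp add: tanh_real_less_iff)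
  show "tanh (real i * s) + tanh (real (i + 2) * s) < 2 * tanh (real (i + 1) * s)" for i
  proof -
    define x where "x = real (i + 1) * s"
    have "x > 0" using s by (simp add: x_def)
    then have "0 < 2 * (sinh s)\<^sup>2 * sinh x / (cosh x * (cosh (x - s) * cosh (x + s)))"
      using s by (intro divide_pos_pos mult_pos_pos) auto
    then have "tanh (x - s) + tanh (x + s) < 2 * tanh x"
      using tanh_second_difference[of x s] by linarith
    moreover have "x - s = real i * s" "x + s = real (i + 2) * s"
      by (simp_all add: x_def algebra_simps)
    ultimately show ?thesis by (simp add: x_def)
  qed
qed

text \<open>A slope is \<open>sinh s\<close> over the product of the \<open>cosh\<close> values at
  its two ends, so consecutive slopes have ratio \<open>cosh ((i + 2) * s) / cosh (i * s)\<close>,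
  at most \<open>exp (2 * s)\<close>.\<close>

lemma tanh_slope_less:
  assumes "exp (2 * s) < 2"
  shows "tanh (real (i + 1) * s) - tanh (real i * s) < 2 * (tanh (real (i + 2) * s) - tanh (real (i + 1) * s))"
proof -
  define u v w where "u = cosh (real i * s)" "v = cosh (real (i + 1) * s)" "w = cosh (real (i + 2) * s)"
  have pos: "u > 0" "v > 0" "w > 0" "sinh s > 0" using s by (auto simp: u_v_w_def)
  have "w \<le> exp (2 * s) * u"
    using cosh_add_le_exp[of "2 * s" "real i * s"] s by (simp add: u_v_w_def algebra_simps)
  also have "\<dots> < 2 * u" using assms pos by simp
  finally have "w < 2 * u" .
  then have "sinh s / (v * u) < 2 * (sinh s / (w * v))"
    using pos by (simp add: field_simps)
  moreover have "tanh (real (i + 1) * s) - tanh (real i * s) = sinh s / (v * u)"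
    "tanh (real (i + 2) * s) - tanh (real (i + 1) * s) = sinh s / (w * v)"
    unfolding tanh_diff_eq u_v_w_def by (simp_all add: algebra_simps)
  ultimately show ?thesis by simp
qed

text \<open>On the left stands the gain from replacing the lengths \<open>i\<close> and
  \<open>i + 2\<close> by two lengths \<open>i + 1\<close>; on the right a lower bound for the
  product of two weights when no arc is longer than \<open>i + 2\<close>.\<close>

lemma tanh_concavity_gap_less:
  assumes "exp (2 * s) < 2"
  shows "sinh (2 * s) * (2 * tanh (real (i + 1) * s) - tanh (real i * s) - tanh (real (i + 2) * s))
    < 1 / (cosh (real (i + 2) * s))\<^sup>2"
proof -
  define x where "x = real (i + 1) * s"
  define e where "e = exp (2 * s)"
  have e: "1 < e" "e < 2" using s assms by (simp_all add: e_def)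
  have xs: "x - s = real i * s" "x + s = real (i + 2) * s" by (simp_all add: x_def algebra_simps)
  define u w where "u = cosh (x - s)" "w = cosh (x + s)"
  have pos: "u > 0" "w > 0" by (simp_all add: u_w_def)
  have "w \<le> exp (2 * s) * u" using cosh_add_le_exp[of "2 * s" "x - s"] s by (simp add: u_w_def add.commute)
  also have "\<dots> < 2 * u" using assms pos by simp
  finally have wu: "w < 2 * u" .
  have "1 / 2 < 1 / e" using e by (simp add: field_simps)
  moreover have "sinh (2 * s) = (e - 1 / e) / 2" "cosh (2 * s) = (e + 1 / e) / 2"
    by (simp_all add: sinh_field_def cosh_field_def e_def exp_minus field_simps)
  moreover have "e + 1 / e < 5 / 2"
  proof -
    have "(e - 2) * (e - 1 / 2) < 0" using e by (intro mult_neg_pos) auto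
    moreover have "(e - 2) * (e - 1 / 2) = e * e - e * (5 / 2) + 1" by (simp add: field_simps)
    ultimately have "e * e + 1 < e * (5 / 2)" by linarith
    then show ?thesis using e by (simp add: field_simps)
  qed
  moreover have "cosh (2 * s) = 2 * (sinh s)\<^sup>2 + 1"
    by (simp add: cosh_double cosh_square_eq)
  ultimately have sh: "sinh (2 * s) < 3 / 4 \<and> (sinh s)\<^sup>2 < 1 / 8" using e by argo
  \<comment> \<open>The factors \<open>3 / 4\<close> and \<open>1 / 8\<close> are the values at
    \<open>e = 2\<close>. Since \<open>w < 2 * u\<close>, any bound up to \<open>1 / 4\<close> for
    the product would suffice.\<close>
  have "sinh (2 * s) * (sinh s)\<^sup>2 \<le> 3 / 4 * (1 / 8)"
    using sh s by (intro mult_mono) auto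
  then have sm: "2 * (sinh (2 * s) * (sinh s)\<^sup>2) * w < u"
  proof -
    have "2 * (sinh (2 * s) * (sinh s)\<^sup>2) * w \<le> 1 / 2 * w"
      using \<open>sinh (2 * s) * (sinh s)\<^sup>2 \<le> 3 / 4 * (1 / 8)\<close> pos by (intro mult_right_mono) auto
    then show ?thesis using wu by simp
  qed
  have tx: "tanh x \<le> 1" using tanh_real_lt_1[of x] by simp
  have "sinh (2 * s) * (2 * tanh x - tanh (x - s) - tanh (x + s)) =
      2 * (sinh (2 * s) * (sinh s)\<^sup>2) * tanh x / (u * w)"
    unfolding tanh_second_difference u_w_def by (simp add: tanh_def)
  also have "\<dots> \<le> 2 * (sinh (2 * s) * (sinh s)\<^sup>2) * 1 / (u * w)"
    using tx pos s by (intro divide_right_mono mult_left_mono) auto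
  also have "\<dots> < 1 / w\<^sup>2"
    using sm pos by (simp add: field_simps power2_eq_square)
  finally show ?thesis unfolding u_w_def xs unfolding x_def .
qed

end

text \<open>The equation makes both residuals on \<open>B_graph m p m\<close> vanish. At
  \<open>s0 = ln 2 / 2\<close>, where \<open>exp (2 * s0) = 2\<close>, lengths of at least 3 make
  the left side at least \<open>3 / 4 * (7 / 3) = 7 / 4\<close>, above
  \<open>cosh (2 * s0) = 5 / 4\<close>; so there is a root below \<open>s0\<close>.\<close>

lemma ex_tanh_root:
  assumes "m \<ge> 3" "p \<ge> 3"
  shows "\<exists>s>0. exp (2 * s) < 2 \<and> sinh (2 * s) * (2 * tanh (real m * s) + tanh (real p * s)) = cosh (2 * s)"
proof -
  define g :: "real \<Rightarrow> real" where "g s = sinh (2 * s) * (2 * tanh (real m * s) + tanh (real p * s)) - cosh (2 * s)" for s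
  define s0 :: real where "s0 = ln 2 / 2"
  have s0: "s0 > 0" by (simp add: s0_def)
  have e: "exp (2 * s0) = 2" "exp (- (2 * s0)) = 1 / 2" by (simp_all add: s0_def exp_minus)
  have sc: "sinh (2 * s0) = 3 / 4" "cosh (2 * s0) = 5 / 4"
    unfolding sinh_field_def cosh_field_def e by simp_all
  have t3: "tanh (3 * s0) = 7 / 9"
  proof -
    have "exp (- 2 * (3 * s0)) = exp (- (2 * s0)) ^ 3"
      by (simp add: exp_of_nat_mult[symmetric])
    then have "exp (- 2 * (3 * s0)) = 1 / 8" unfolding e(2) by (simp add: power3_eq_cube)
    then have "tanh (3 * s0) = (1 - 1 / 8) / (1 + 1 / 8)"
      using tanh_real_altdef[of "3 * s0"] by (simp only:)
    then show ?thesis by simp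
  qed
  have tl: "tanh (real l * s0) \<ge> 7 / 9" if "l \<ge> 3" for l
  proof -
    have "3 * s0 \<le> real l * s0" using that s0 by (intro mult_right_mono) auto
    then show ?thesis unfolding t3[symmetric] by (simp only: tanh_real_le_iff)
  qed
  have "g 0 \<le> 0" by (simp add: g_def)
  moreover have g1: "0 < g s0"
  proof -
    have "2 * tanh (real m * s0) + tanh (real p * s0) \<ge> 7 / 3"
      using tl[OF assms(1)] tl[OF assms(2)] by simp
    then show ?thesis unfolding g_def sc by simp
  qed
  moreover have "continuous_on {0..s0} g"
    unfolding g_def by (intro continuous_intros) (auto simp: cosh_real_nonzero)
  ultimately obtain s where s: "0 \<le> s" "s \<le> s0" "g s = 0"
    using IVT'[of g 0 0 s0] s0 by auto
  have "s \<noteq> 0" using s(3) by (auto simp: g_def)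
  moreover have "s \<noteq> s0" using s(3) g1 by auto
  ultimately have "0 < s" "s < s0" using s by auto
  moreover from this have "exp (2 * s) < exp (2 * s0)" by simp
  ultimately show ?thesis using s(3) e(1) by (intro exI[of _ s]) (simp add: g_def)
qed

section \<open>Extremal graphs\<close>

lemma symcl_eq: "sym R \<Longrightarrow> R\<^sup>s = R"
  by (auto simp: symcl_def sym_def)

lemma connected_graphsD:
  assumes "G \<in> connected_graphs n a"
  shows "finite (pverts G)" "sym (parcs G)" "(v, v) \<notin> parcs G" "parcs G \<subseteq> pverts G \<times> pverts G"
    "u \<in> pverts G \<Longrightarrow> v \<in> pverts G \<Longrightarrow> (u, v) \<in> (parcs G)\<^sup>*"
    "card (pverts G) = n" "int (independence_number G) = a"
proof -
  interpret pair_graph G using assms by (simp add: connected_graphs_def)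
  show "finite (pverts G)" by (rule pair_finite_verts)
  show sym: "sym (parcs G)" by (rule symI) (rule arcs_symmetric)
  show "(v, v) \<notin> parcs G" using no_loops' by blast
  show "parcs G \<subseteq> pverts G \<times> pverts G" using in_arcsD1 in_arcsD2 by auto
  show "card (pverts G) = n" "int (independence_number G) = a"
    using assms by (simp_all add: connected_graphs_def)
  assume uv: "u \<in> pverts G" "v \<in> pverts G"
  have "Digraph_Component.connected (with_proj G)" using assms by (simp add: connected_graphs_def)
  then have "(u, v) \<in> rtrancl_on (pverts G) ((parcs G)\<^sup>s)"
    using uv unfolding connected_conv by simp
  then show "(u, v) \<in> (parcs G)\<^sup>*" unfolding symcl_eq[OF sym] by (rule rtrancl_on_rtranclI)
qed

lemma nat_graph_in_connected_graphs:
  assumes N: "N > 0" and path: "path_arcs 0 (N - 1) \<subseteq> A" and "sym A" and A: "A \<subseteq> {..<N} \<times> {..<N}"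
    and irrefl: "\<And>i. (i, i) \<notin> A" and G: "G = \<lparr>pverts = {..<N}, parcs = A\<rparr>"
  shows "G \<in> connected_graphs N (int (independence_number G))"
proof -
  have "pair_graph G"
  proof
    show "finite (parcs G)" using A finite_subset[of A "{..<N} \<times> {..<N}"] by (simp add: G)
    show "symmetric (with_proj G)" using assms(3) by (simp add: symmetric_def G)
    show "fst e \<noteq> snd e" if "e \<in> parcs G" for e using that irrefl by (cases e) (auto simp: G)
  qed (use A in \<open>auto simp: G\<close>)
  moreover have "Digraph_Component.connected (with_proj G)"
  proof -
    have reach: "(0, i) \<in> rtrancl_on {..<N} A" if "i < N" for i
      using that
    proof (induction i)
      case 0
      then show ?case by (simp add: rtrancl_on_refl)
    next
      case (Suc i)
      then have "(i, Suc i) \<in> A" using path by (auto simp: mem_path_arcs_iff)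
      moreover have "(0, i) \<in> rtrancl_on {..<N} A" using Suc by simp
      ultimately show ?case using Suc.prems by (intro rtrancl_on_into_rtrancl_on[of 0 i "{..<N}" A "Suc i"]) auto
    qed
    have "(i, j) \<in> rtrancl_on {..<N} A" if "i < N" "j < N" for i j
      using rtrancl_on_trans[OF symD[OF rtrancl_on_sym[OF assms(3)] reach[OF that(1)]] reach[OF that(2)]] .
    then show ?thesis unfolding connected_conv using N by (auto simp: G symcl_eq[OF assms(3)])
  qed
  ultimately show ?thesis by (simp add: connected_graphs_def G)
qed

lemma digraph_iso_of_enumeration:
  assumes "pair_graph G" "inj_on h {..<N}" "h ` {..<N} = pverts G"
    and H: "H = \<lparr>pverts = {..<N}, parcs = pullback N h (parcs G)\<rparr>"
  shows "digraph_iso (with_proj G) (with_proj H)"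
proof -
  interpret pair_graph G by fact
  define g where "g = the_inv_into {..<N} h"
  have gh: "g (h i) = i" if "i < N" for i using assms(2) that by (simp add: g_def the_inv_into_f_f)
  have g: "g v < N" "h (g v) = v" if "v \<in> pverts G" for v
    using that gh unfolding assms(3)[symmetric] by auto
  define f where "f = \<lparr>iso_verts = g, iso_arcs = map_prod g g, iso_head = snd, iso_tail = fst\<rparr>"
  have "inj_on (map_prod g g) (parcs G)"
  proof (rule inj_onI)
    fix x y assume "x \<in> parcs G" "y \<in> parcs G" "map_prod g g x = map_prod g g y"
    then show "x = y"
      using in_arcsD1 in_arcsD2 g(2) by (cases x; cases y) (simp, metis)
  qed
  moreover have "inj_on g (pverts G)" using g(2) by (metis inj_onI)
  ultimately have "digraph_isomorphism f"
    unfolding digraph_isomorphism_def by (auto simp: f_def wf_digraph)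
  moreover have "with_proj H = app_iso f (with_proj G)"
  proof -
    have "g ` pverts G = {..<N}" using gh unfolding assms(3)[symmetric] by force
    moreover have "map_prod g g ` parcs G = pullback N h (parcs G)"
    proof
      show "map_prod g g ` parcs G \<subseteq> pullback N h (parcs G)"
        using in_arcsD1 in_arcsD2 g by (auto simp: pullback_def)
      show "pullback N h (parcs G) \<subseteq> map_prod g g ` parcs G"
      proof
        fix e assume "e \<in> pullback N h (parcs G)"
        then obtain i j where "e = (i, j)" "i < N" "j < N" "(h i, h j) \<in> parcs G"
          by (auto simp: pullback_def)
        then show "e \<in> map_prod g g ` parcs G"
          using gh by (intro image_eqI[of _ _ "(h i, h j)"]) auto
      qed
    qed
    ultimately show ?thesis
      by (simp add: H f_def with_proj_def app_iso_def)
  qed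
  ultimately show ?thesis unfolding digraph_iso_def by blast
qed

section \<open>Independence numbers of cycles and the odd case\<close>

lemma card_independent_interval:
  assumes "\<And>j. b \<le> j \<Longrightarrow> Suc j < b + 2 * t \<Longrightarrow> j \<in> S \<Longrightarrow> Suc j \<notin> S"
  shows "card (S \<inter> {b..<b + 2 * t}) \<le> t"
  using assms
proof (induction t)
  case (Suc t)
  have "S \<inter> {b..<b + 2 * Suc t} = (S \<inter> {b..<b + 2 * t}) \<union> (S \<inter> {b + 2 * t, Suc (b + 2 * t)})" by auto
  then have "card (S \<inter> {b..<b + 2 * Suc t}) \<le> card (S \<inter> {b..<b + 2 * t}) + card (S \<inter> {b + 2 * t, Suc (b + 2 * t)})"
    by (simp only: card_Un_le)
  moreover have "card (S \<inter> {b + 2 * t, Suc (b + 2 * t)}) \<le> 1"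
  proof -
    have "S \<inter> {b + 2 * t, Suc (b + 2 * t)} \<subseteq> {if b + 2 * t \<in> S then b + 2 * t else Suc (b + 2 * t)}"
      using Suc.prems[of "b + 2 * t"] by auto
    from card_mono[OF _ this] show ?thesis by simp
  qed
  moreover have "card (S \<inter> {b..<b + 2 * t}) \<le> t"
    using Suc.prems by (intro Suc.IH) auto
  ultimately show ?case by linarith
qed simp

text \<open>Discard an end of the closing edge that is not in \<open>S\<close>; the other
  \<open>2 * t\<close> vertices form \<open>t\<close> consecutive pairs.\<close>

lemma card_independent_odd_cycle:
  assumes "\<And>j. b \<le> j \<Longrightarrow> Suc j \<le> b + 2 * t \<Longrightarrow> j \<in> S \<Longrightarrow> Suc j \<notin> S" "\<not> (b \<in> S \<and> b + 2 * t \<in> S)"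
  shows "card (S \<inter> {b..b + 2 * t}) \<le> t"
proof (cases "b \<in> S")
  case True
  have "{b..b + 2 * t} = insert (b + 2 * t) {b..<b + 2 * t}" by auto
  then have "S \<inter> {b..b + 2 * t} = S \<inter> {b..<b + 2 * t}" using True assms(2) by simp
  also have "card \<dots> \<le> t" using assms(1) by (intro card_independent_interval) auto
  finally show ?thesis .
next
  case False
  have "{b..b + 2 * t} = insert b {Suc b..<Suc b + 2 * t}" by auto
  then have "S \<inter> {b..b + 2 * t} = S \<inter> {Suc b..<Suc b + 2 * t}" using False by simp
  also have "card \<dots> \<le> t" using assms(1) by (intro card_independent_interval) auto
  finally show ?thesis .
qed

lemma cycle_graph_eq:
  assumes "n \<ge> 3"
  shows "cycle_graph n = \<lparr>pverts = {..<n}, parcs = path_arcs 0 (n - 1) \<union> {(0, n - 1), (n - 1, 0)}\<rparr>"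
  using assms by (simp add: cycle_graph_def cycle_arcs_eq)

lemma mem_cycle_graph_arcs_iff:
  "(i, j) \<in> path_arcs 0 (n - 1) \<union> {(0, n - 1), (n - 1, 0)} \<longleftrightarrow>
    (Suc i < n \<and> j = Suc i) \<or> (Suc j < n \<and> i = Suc j) \<or> (i = 0 \<and> j = n - 1) \<or> (i = n - 1 \<and> j = 0)"
  by (auto simp: mem_path_arcs_iff)

lemma cycle_graph_in_connected_graphs:
  assumes "odd n" "n \<ge> 3"
  shows "cycle_graph n \<in> connected_graphs n (\<lceil>real n / 2\<rceil> - 1)"
proof -
  let ?A = "path_arcs 0 (n - 1) \<union> {(0, n - 1), (n - 1, 0)}"
  note eq = cycle_graph_eq[OF assms(2)]
  obtain t where t: "n = 2 * t + 1" using assms(1) by (rule oddE)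
  have "independence_number (cycle_graph n) \<le> t"
  proof (rule independence_number_le)
    fix S assume S: "independent_set (cycle_graph n) S"
    have "S \<subseteq> {0..0 + 2 * t}" using S unfolding independent_set_def eq by (auto simp: t)
    then have "S = S \<inter> {0..0 + 2 * t}" by blast
    also have "card \<dots> \<le> t"
    proof (rule card_independent_odd_cycle)
      fix j assume "Suc j \<le> 0 + 2 * t" "j \<in> S"
      moreover from this have "(j, Suc j) \<in> ?A" unfolding mem_cycle_graph_arcs_iff t by simp
      ultimately show "Suc j \<notin> S" using S by (auto simp: independent_set_def eq)
    next
      have "(0, n - 1) \<in> ?A" by simp
      then have "\<not> (0 \<in> S \<and> n - 1 \<in> S)" using S unfolding independent_set_def eq by auto
      then show "\<not> (0 \<in> S \<and> 0 + 2 * t \<in> S)" using t by simp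
    qed
    finally show "card S \<le> t" .
  qed (simp add: eq)
  \<comment> \<open>Without its last vertex the cycle is a path on \<open>2 * t\<close> vertices,
    coloured by parity.\<close>
  moreover have "card {..<n - 1} \<le> 2 * independence_number (cycle_graph n)"
  proof (rule card_le_twice_independence_number)
    show "finite (pverts (cycle_graph n))" "{..<n - 1} \<subseteq> pverts (cycle_graph n)" by (auto simp: eq)
    fix u v assume "u \<in> {..<n - 1}" "v \<in> {..<n - 1}" "(u, v) \<in> parcs (cycle_graph n)"
    then have "v = Suc u \<or> u = Suc v" by (auto simp: eq mem_path_arcs_iff)
    then show "even u \<noteq> even v" by auto
  qed
  ultimately have "independence_number (cycle_graph n) = t" using t by simp
  moreover have "cycle_graph n \<in> connected_graphs n (int (independence_number (cycle_graph n)))"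
  proof (rule nat_graph_in_connected_graphs[OF _ _ _ _ _ eq])
    show "sym ?A" by (rule symI) (unfold mem_cycle_graph_arcs_iff, blast)
    show "?A \<subseteq> {..<n} \<times> {..<n}" using assms by (auto simp: mem_path_arcs_iff)
    show "(i, i) \<notin> ?A" for i using assms unfolding mem_cycle_graph_arcs_iff by auto
  qed (use assms in auto)
  moreover have "\<lceil>real n / 2\<rceil> - 1 = int t"
  proof -
    have "real n / 2 = real t + 1 / 2" using t by simp
    then have "\<lceil>real n / 2\<rceil> = int t + 1" by (intro ceiling_unique) auto
    then show ?thesis by simp
  qed
  ultimately show ?thesis by simp
qed

lemma nbr_sum_cycle_graph:
  assumes "n \<ge> 3" "i < n"
  shows "nbr_sum {..<n} (path_arcs 0 (n - 1) \<union> {(0, n - 1), (n - 1, 0)}) (\<lambda>_. 1) i = 2"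
proof -
  let ?A = "path_arcs 0 (n - 1) \<union> {(0, n - 1), (n - 1, 0)}"
  have "nbr_sum {..<n} ?A (\<lambda>_. 1) i = (\<Sum>j\<in>{j\<in>{..<n}. (i, j) \<in> ?A}. 1)"
    unfolding nbr_sum_def by (intro sum.mono_neutral_cong_right) auto
  also have "\<dots> = real (card {j\<in>{..<n}. (i, j) \<in> ?A})" by simp
  also have "{j\<in>{..<n}. (i, j) \<in> ?A} =
      {if i = n - 1 then 0 else Suc i, if i = 0 then n - 1 else i - 1}"
    unfolding mem_cycle_graph_arcs_iff using assms by auto
  also have "card \<dots> = 2" using assms by auto
  finally show ?thesis by simp
qed

lemma spectral_radius_cycle_graph_le:
  assumes "n \<ge> 3"
  shows "graph_spectral_radius (cycle_graph n) \<le> 2"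
proof (rule graph_spectral_radius_le[where f = "\<lambda>_. 1"])
  show "sym (parcs (cycle_graph n))"
    unfolding cycle_graph_eq[OF assms] by (rule symI) (simp only: pair_pre_digraph.simps, unfold mem_cycle_graph_arcs_iff, blast)
qed (use assms nbr_sum_cycle_graph in \<open>auto simp: cycle_graph_eq lessThan_empty_iff\<close>)

lemma is_cycle_mono: "is_cycle R m c \<Longrightarrow> R \<subseteq> E \<Longrightarrow> is_cycle E m c"
  by (auto simp: is_cycle_def)

lemma ex_odd_cycle_if_small_independence:
  assumes fin: "finite (pverts G)" and "sym (parcs G)" and irrefl: "\<And>v. (v, v) \<notin> parcs G"
    and S: "S \<subseteq> pverts G" and small: "2 * independence_number G < card S"
  obtains m c where "odd m" "is_cycle (parcs G) m c" "range c \<subseteq> S"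
proof -
  define R where "R = parcs G \<inter> S \<times> S"
  have "sym R" using assms(2) by (auto simp: R_def sym_def)
  moreover have "\<nexists>colour :: 'a \<Rightarrow> bool. \<forall>(x, y)\<in>R. colour x \<noteq> colour y"
  proof
    assume "\<exists>colour :: 'a \<Rightarrow> bool. \<forall>(x, y)\<in>R. colour x \<noteq> colour y"
    then obtain colour :: "'a \<Rightarrow> bool" where "\<And>x y. (x, y) \<in> R \<Longrightarrow> colour x \<noteq> colour y" by blast
    then have "card S \<le> 2 * independence_number G"
      by (intro card_le_twice_independence_number[OF fin S, of colour]) (auto simp: R_def)
    then show False using small by simp
  qed
  ultimately obtain m c where c: "odd m" "is_cycle R m c"
    using ex_colouring_or_odd_cycle[of R] irrefl unfolding R_def by blast
  then have "range c \<subseteq> S" unfolding is_cycle_def R_def by blast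
  then show thesis using that[OF c(1) is_cycle_mono[OF c(2)]] by (simp add: R_def)
qed

lemma odd_order_extremal:
  assumes G: "G \<in> connected_graphs n (\<lceil>real n / 2\<rceil> - 1)" and n: "odd n" "n \<ge> 3"
    and rho: "graph_spectral_radius G \<le> 2"
  shows "digraph_iso (with_proj G) (with_proj (cycle_graph n))"
proof -
  let ?V = "pverts G" and ?E = "parcs G"
  note G' = connected_graphsD[OF G]
  obtain t where t: "n = 2 * t + 1" using n(1) by (rule oddE)
  have "\<lceil>real n / 2\<rceil> = int t + 1" using t by (intro ceiling_unique) auto
  then have "2 * independence_number G < card ?V" using G'(6,7) t by simp
  then obtain m c where c: "is_cycle ?E m c" "range c \<subseteq> ?V"
    using ex_odd_cycle_if_small_independence[OF G'(1,2,3), of ?V] by blast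
  have m: "m \<ge> 3" "inj_on c {..<m}" using c by (simp_all add: is_cycle_def)
  let ?A = "path_arcs 0 (m - 1) \<union> {(0, m - 1), (m - 1, 0)}"
  interpret spectral_embedding ?V ?E 2 m c "\<lambda>_. 1"
  proof
    show "qform ?V ?E 2 g \<le> 0" for g
      by (rule qform_nonpos_if_spectral_radius_le[OF G'(1,2) rho])
  qed (use G' m c in auto)
  have step: "(c i, c (Suc i)) \<in> ?E \<and> (c (Suc i), c i) \<in> ?E" for i
    using c(1) symD[OF G'(2)] by (auto simp: is_cycle_def)
  have last: "(c (m - 1), c 0) \<in> ?E \<and> (c 0, c (m - 1)) \<in> ?E"
    using step[of "m - 1"] c(1) m(1) by (auto simp: is_cycle_def dest: spec[of _ 0])
  have sub: "?A \<subseteq> pullback m c ?E"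
  proof (rule subrelI)
    fix i j assume "(i, j) \<in> ?A"
    then show "(i, j) \<in> pullback m c ?E"
      unfolding mem_cycle_graph_arcs_iff using step last m(1) by (auto simp: pullback_def)
  qed
  have P: "pullback m c ?E \<subseteq> {..<m} \<times> {..<m}" "sym (pullback m c ?E)"
    using symD[OF G'(2)] by (auto simp: pullback_def sym_def)
  have symA: "sym ?A" by (rule symI) (unfold mem_cycle_graph_arcs_iff, blast)
  have qA: "qform {..<m} ?A 2 (\<lambda>_. 1) = 0"
    unfolding qform_def using nbr_sum_cycle_graph[OF m(1)] by simp
  \<comment> \<open>A chord of the cycle would raise the form from 0 to at least 2.\<close>
  have "pullback m c ?E \<subseteq> ?A"
  proof (rule subrelI, rule ccontr)
    fix i j assume ij: "(i, j) \<in> pullback m c ?E" "(i, j) \<notin> ?A"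
    then have "i \<noteq> j" using G'(3) by (auto simp: pullback_def)
    then have "qform {..<m} ?A 2 (\<lambda>_. 1) + 2 * 1 * 1 \<le> qform {..<m} (pullback m c ?E) 2 (\<lambda>_. 1)"
      using ij by (intro qform_add_edge[OF _ sub P(1) _ P(2) symA]) auto
    then show False using qA qform_pullback_le_0 by simp
  qed
  then have eq: "pullback m c ?E = ?A" using sub by blast
  have sp: "c ` {..<m} = ?V" using spanning qA eq by simp
  then have "m = n" using card_image[OF m(2)] G'(6) by simp
  then show ?thesis
    using digraph_iso_of_enumeration[OF _ m(2) sp refl] G eq cycle_graph_eq[OF n(2)]
    by (simp add: connected_graphs_def)
qed

section \<open>Lollipops in graphs of even order\<close>

lemma sym_pullback: "sym E \<Longrightarrow> sym (pullback N h E)"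
  by (auto simp: pullback_def sym_def)

lemma pullback_subset: "pullback N h E \<subseteq> {..<N} \<times> {..<N}"
  by (auto simp: pullback_def)

text \<open>The independence number enters only through \<open>not_bipartite\<close>, the spectral
  radius only through \<open>nonpos\<close>.\<close>

locale lollipop_graph = chord_model +
  fixes V :: "'a set" and E :: "'a rel" and h :: "nat \<Rightarrow> 'a"
  assumes fin: "finite V" and sym: "sym E" and irrefl: "\<And>v. (v, v) \<notin> E" and sub: "E \<subseteq> V \<times> V"
    and conn: "\<And>u v. u \<in> V \<Longrightarrow> v \<in> V \<Longrightarrow> (u, v) \<in> E\<^sup>*"
    and nonpos: "\<And>g. qform V E (2 * cosh (2 * s)) g \<le> 0"
    and not_bipartite: "\<And>v (colour :: 'a \<Rightarrow> bool). v \<in> V \<Longrightarrow>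
       \<exists>u\<in>V - {v}. \<exists>u'\<in>V - {v}. (u, u') \<in> E \<and> colour u = colour u'"
    and lollipop: "is_lollipop E N y z h"
    and s_pos: "s > 0"
begin

lemma inj: "inj_on h {..<N}"
  using lollipop by (simp add: is_lollipop_def)

lemma hV: "h ` {..<N} \<subseteq> V"
proof -
  have "h i \<in> V" if "i < N" for i
  proof (cases "Suc i < N")
    case True
    then have "(h i, h (Suc i)) \<in> E" using lollipop by (simp add: is_lollipop_def)
    then show ?thesis using sub by blast
  next
    case False
    then have "i = N - 1" using that by simp
    then have "(h z, h i) \<in> E" using lollipop by (simp add: is_lollipop_def)
    then show ?thesis using sub by blast
  qed
  then show ?thesis by blast
qed

sublocale emb: spectral_embedding V E "2 * cosh (2 * s)" N h w
  using fin sym sub conn nonpos inj hV bounds w_pos by unfold_locales auto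

lemma N_le: "N \<le> card V"
  using card_mono[OF fin hV] card_image[OF inj] by simp

lemma chord_sub: "chord_arcs N y z \<subseteq> pullback N h E"
  by (rule chord_arcs_subset_pullback[OF sym lollipop])

lemma tanh_sum_ge:
  "cosh (2 * s) \<le> sinh (2 * s) * (tanh (real a * s) + tanh (real b * s) + tanh (real c * s))"
proof -
  have "qform {..<N} (chord_arcs N y z) (2 * cosh (2 * s)) w \<le> qform {..<N} (pullback N h E) (2 * cosh (2 * s)) w"
    using w_pos by (intro qform_mono_arcs chord_sub pullback_subset) (auto simp: less_imp_le)
  then show ?thesis using emb.qform_pullback_le_0 unfolding qform_chord_arcs by simp
qed

text \<open>A host edge outside the lollipop adds \<open>2 * w i * w j\<close> to the form, which
  must stay nonpositive.\<close>

lemma extra_edge: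
  assumes "pullback N h E \<noteq> chord_arcs N y z"
  shows "\<exists>i<N. \<exists>j<N. cosh (2 * s) + w i * w j
    \<le> sinh (2 * s) * (tanh (real a * s) + tanh (real b * s) + tanh (real c * s))"
proof -
  obtain i j where ij: "(i, j) \<in> pullback N h E" "(i, j) \<notin> chord_arcs N y z"
    using assms chord_sub by auto
  then have lt: "i < N" "j < N" "i \<noteq> j" using irrefl by (auto simp: pullback_def)
  have "qform {..<N} (chord_arcs N y z) (2 * cosh (2 * s)) w + 2 * w i * w j
      \<le> qform {..<N} (pullback N h E) (2 * cosh (2 * s)) w"
    using ij lt w_pos
    by (intro qform_add_edge[OF _ chord_sub pullback_subset _ sym_pullback[OF sym] sym_chord_arcs])
      (auto simp: less_imp_le)
  then have "cosh (2 * s) + w i * w j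
    \<le> sinh (2 * s) * (tanh (real a * s) + tanh (real b * s) + tanh (real c * s))"
    using emb.qform_pullback_le_0 unfolding qform_chord_arcs by simp
  then show ?thesis using lt by blast
qed

text \<open>The host is just the lollipop, so a vertex and colouring from
  \<open>chord_arcs_colouring\<close> would contradict \<open>not_bipartite\<close>.\<close>

lemma odd_dumbbell:
  assumes eq: "pullback N h E = chord_arcs N y z" and sp: "h ` {..<N} = V"
  shows "y < z" "odd a" "odd c"
proof -
  have "y < z \<and> even y \<and> even (N - 1 - z)"
  proof (rule ccontr)
    assume "\<not> (y < z \<and> even y \<and> even (N - 1 - z))"
    from chord_arcs_colouring[OF bounds this] obtain v and colour :: "nat \<Rightarrow> bool" where
      v: "v < N" and colour: "\<And>i j. (i, j) \<in> chord_arcs N y z \<Longrightarrow> i \<noteq> v \<Longrightarrow> j \<noteq> v \<Longrightarrow> colour i \<noteq> colour j"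
      by blast
    define g where "g = the_inv_into {..<N} h"
    have gh: "g (h i) = i" if "i < N" for i using inj that by (simp add: g_def the_inv_into_f_f)
    have "h v \<in> V" using v sp by blast
    then obtain u u' where u: "u \<in> V - {h v}" "u' \<in> V - {h v}" "(u, u') \<in> E" "colour (g u) = colour (g u')"
      using not_bipartite[of "h v" "\<lambda>u. colour (g u)"] by blast
    then obtain i j where ij: "i < N" "j < N" "u = h i" "u' = h j" using sp by blast
    then have "(i, j) \<in> chord_arcs N y z" using u(3) unfolding eq[symmetric] by (simp add: pullback_def)
    moreover have "i \<noteq> v" "j \<noteq> v" using u ij by auto
    ultimately show False using colour[of i j] u(4) ij gh by simp
  qed
  then show "y < z" "odd a" "odd c"
    using bounds unfolding a_def c_def by (auto simp: min_def max_def)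
qed

lemma spanning_if_card: "N = card V \<Longrightarrow> h ` {..<N} = V"
  using card_subset_eq[OF fin hV] card_image[OF inj] by simp

lemma extra_edge_if_even:
  assumes "N = card V" "\<not> (odd a \<and> odd c)"
  shows "\<exists>i<N. \<exists>j<N. cosh (2 * s) + w i * w j
    \<le> sinh (2 * s) * (tanh (real a * s) + tanh (real b * s) + tanh (real c * s))"
  using odd_dumbbell[OF _ spanning_if_card[OF assms(1)]] extra_edge assms(2) by blast

text \<open>Equality makes \<open>w\<close> an eigenvector of the host. Then the residuals vanish at
  \<open>y\<close> and at \<open>z\<close> separately, not only in sum, and their difference forces
  \<open>a = c\<close>; this excludes the orders in which the odd arc lengths are attached
  wrongly.\<close>

lemma extremal:
  assumes "cosh (2 * s) = sinh (2 * s) * (tanh (real a * s) + tanh (real b * s) + tanh (real c * s))"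
  shows "pullback N h E = chord_arcs N y z" "h ` {..<N} = V" "y < z" "a = c" "odd a"
proof -
  show eq: "pullback N h E = chord_arcs N y z"
  proof (rule ccontr)
    assume "pullback N h E \<noteq> chord_arcs N y z"
    from extra_edge[OF this] obtain i j where "w i * w j \<le> 0" using assms by auto
    then show False using w_pos[of i] w_pos[of j] by (simp add: mult_le_0_iff)
  qed
  then have zero: "qform {..<N} (pullback N h E) (2 * cosh (2 * s)) w = 0"
    unfolding eq qform_chord_arcs using assms by simp
  show sp: "h ` {..<N} = V" by (rule emb.spanning[OF zero])
  show yz: "y < z" and "odd a" using odd_dumbbell[OF eq sp] by simp_all
  have "defect y = 0" "defect z = 0"
    using emb.eigen_pullback[OF zero] bounds unfolding eq defect_def by simp_all
  then have "arc_weight s a 1 = arc_weight s c 1" using defect_dumbbell[OF yz] by simp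
  then have "tanh (real a * s) = tanh (real c * s)"
    unfolding arc_weight_1 using s_pos by simp
  then show "a = c" using s_pos by (simp add: tanh_real_eq_iff)
qed

lemma weight_ge:
  assumes "a \<le> L" "b \<le> L" "c \<le> L"
  shows "w i \<ge> 1 / cosh (real L * s)"
proof -
  have "1 / cosh (real L * s) \<le> arc_weight s l j" if "l \<le> L" for l j
  proof -
    have "cosh (real l * s) \<le> cosh (real L * s)"
      using that s_pos by (subst cosh_real_nonneg_le_iff) (auto intro: mult_right_mono)
    then have "1 / cosh (real L * s) \<le> 1 / cosh (real l * s)"
      by (intro divide_left_mono) auto
    then show ?thesis using arc_weight_ge[where s = s and l = l and i = j] by linarith
  qed
  then show ?thesis using assms by (simp add: w_def chord_weight_def)
qed

end

text \<open>Twice the independence number is \<open>n - 2\<close>, less than the number of vertices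
  that remain when any one is deleted, so an odd cycle survives every deletion.\<close>

lemma ex_lollipop_graph:
  assumes G: "G \<in> connected_graphs n (\<lceil>real n / 2\<rceil> - 1)" and n: "even n" "n > 0"
    and s: "s > 0" and rho: "graph_spectral_radius G \<le> 2 * cosh (2 * s)"
  shows "\<exists>N y z h. lollipop_graph N y z s (pverts G) (parcs G) h"
proof -
  let ?V = "pverts G" and ?E = "parcs G"
  note G' = connected_graphsD[OF G]
  obtain t where t: "n = 2 * t" using n(1) by (rule evenE)
  have "\<lceil>real n / 2\<rceil> = int t" using t by simp
  then have "2 * independence_number G < n - 1" using G'(7) t n(2) by simp
  then have small: "2 * independence_number G < card (?V - {v})" for v
    using G'(1,6) by (cases "v \<in> ?V") (auto simp: card_Diff_singleton_if)
  obtain m C where C: "is_cycle ?E m C" "range C \<subseteq> ?V"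
    using ex_odd_cycle_if_small_independence[OF G'(1,2,3) Diff_subset small] by (metis Diff_subset order_trans)
  \<comment> \<open>Avoiding \<open>C 0\<close> keeps \<open>D\<close> from covering
    \<open>C\<close>, so the two cycles span more than one cycle.\<close>
  obtain q D where D: "is_cycle ?E q D" "range D \<subseteq> ?V - {C 0}"
    using ex_odd_cycle_if_small_independence[OF G'(1,2,3) Diff_subset small] by metis
  have "\<not> range C \<subseteq> range D" using D(2) by blast
  then obtain N y z h where h: "is_lollipop ?E N y z h"
    using ex_lollipop[OF G'(2,3) C(1) D(1)] G'(5) C(2) D(2) by blast
  have "lollipop_graph N y z s ?V ?E h"
  proof
    show "2 \<le> y" "y + 1 < N" "z + 3 \<le> N" using h by (auto simp: is_lollipop_def)
    show "qform ?V ?E (2 * cosh (2 * s)) g \<le> 0" for g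
      by (rule qform_nonpos_if_spectral_radius_le[OF G'(1,2) rho])
    show "\<exists>u\<in>?V - {v}. \<exists>u'\<in>?V - {v}. (u, u') \<in> ?E \<and> colour u = colour u'" for v and colour :: "'a \<Rightarrow> bool"
    proof (rule ccontr)
      assume "\<not> ?thesis"
      then have "card (?V - {v}) \<le> 2 * independence_number G"
        by (intro card_le_twice_independence_number[OF G'(1), of _ colour]) auto
      then show False using small[of v] by simp
    qed
  qed (use G' h s in auto)
  then show ?thesis by blast
qed

text \<open>With \<open>m = 2 * t + 1\<close> and \<open>p = 2 * r + 1\<close>, an independent set
  has at most \<open>t\<close> vertices on each cycle and \<open>r\<close> among the
  \<open>2 * r\<close> inner path vertices. Conversely, deleting both branch vertices removes the
  chords and leaves \<open>n - 2\<close> vertices coloured by parity.\<close>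

lemma odd_dumbbell_in_connected_graphs:
  assumes "odd m" "m \<ge> 3" "odd p" "n = 2 * m + p - 1"
  shows "B_graph m p m \<in> connected_graphs n (\<lceil>real n / 2\<rceil> - 1)"
proof -
  define y z where "y = m - 1" "z = m - 1 + p"
  let ?A = "chord_arcs n y z"
  obtain t where t: "m = 2 * t + 1" using assms(1) by (rule oddE)
  obtain r where r: "p = 2 * r + 1" using assms(3) by (rule oddE)
  have yz: "y = 2 * t" "z = 2 * t + 2 * r + 1" "n = 4 * t + 2 * r + 2" "t \<ge> 1"
    using assms t r by (auto simp: y_z_def)
  have eq: "B_graph m p m = \<lparr>pverts = {..<n}, parcs = ?A\<rparr>"
  proof -
    have "m + p + m - 1 = n" using assms by simp
    then show ?thesis using B_graph_eq[of m m p] assms(2) unfolding y_z_def by simp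
  qed
  have upper: "independence_number (B_graph m p m) \<le> 2 * t + r"
  proof (rule independence_number_le)
    fix S assume S: "independent_set (B_graph m p m) S"
    then have ind: "(i, j) \<in> ?A \<Longrightarrow> \<not> (i \<in> S \<and> j \<in> S)" for i j by (auto simp: independent_set_def eq)
    have step: "j \<in> S \<Longrightarrow> Suc j \<notin> S" if "Suc j < n" for j
      using ind[of j "Suc j"] that by (auto simp: mem_chord_arcs_iff)
    have chords: "\<not> (0 \<in> S \<and> 0 + 2 * t \<in> S)" "\<not> (z \<in> S \<and> z + 2 * t \<in> S)"
      using ind[of 0 y] ind[of z "n - 1"] yz by (auto simp: mem_chord_arcs_iff)
    have "S \<subseteq> {..<n}" using S by (auto simp: independent_set_def eq)
    then have "S = (S \<inter> {0..0 + 2 * t}) \<union> (S \<inter> {y + 1..<y + 1 + 2 * r}) \<union> (S \<inter> {z..z + 2 * t})"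
      using yz by auto
    then have "card S \<le> card (S \<inter> {0..0 + 2 * t}) + card (S \<inter> {y + 1..<y + 1 + 2 * r}) + card (S \<inter> {z..z + 2 * t})"
      using card_Un_le by (metis (no_types, lifting) add_le_mono1 order_trans)
    moreover have "card (S \<inter> {0..0 + 2 * t}) \<le> t"
      using step chords yz by (intro card_independent_odd_cycle) auto
    moreover have "card (S \<inter> {y + 1..<y + 1 + 2 * r}) \<le> r"
      using step yz by (intro card_independent_interval) auto
    moreover have "card (S \<inter> {z..z + 2 * t}) \<le> t"
      using step chords yz by (intro card_independent_odd_cycle) auto
    ultimately show "card S \<le> 2 * t + r" by linarith
  qed (simp add: eq)
  have "card ({..<n} - {y, z}) \<le> 2 * independence_number (B_graph m p m)"
  proof (rule card_le_twice_independence_number)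
    fix u v assume "u \<in> {..<n} - {y, z}" "v \<in> {..<n} - {y, z}" "(u, v) \<in> parcs (B_graph m p m)"
    then have "v = Suc u \<or> u = Suc v" by (auto simp: eq mem_chord_arcs_iff)
    then show "even u \<noteq> even v" by auto
  qed (auto simp: eq)
  moreover have "card ({..<n} - {y, z}) = n - 2"
    using yz by (subst card_Diff_subset) auto
  ultimately have "independence_number (B_graph m p m) = 2 * t + r" using upper yz by simp
  moreover have "B_graph m p m \<in> connected_graphs n (int (independence_number (B_graph m p m)))"
  proof (rule nat_graph_in_connected_graphs[OF _ _ sym_chord_arcs chord_arcs_subset _ eq])
    show "(i, i) \<notin> ?A" for i using yz by (auto simp: mem_chord_arcs_iff)
  qed (use yz in \<open>auto simp: chord_arcs_def\<close>)
  moreover have "\<lceil>real n / 2\<rceil> - 1 = int (2 * t + r)"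
  proof -
    have "real n / 2 = of_int (int (2 * t + r + 1))" using yz by simp
    then show ?thesis by (simp only: ceiling_of_int)
  qed
  ultimately show ?thesis by simp
qed

text \<open>The equation for \<open>s\<close> makes both residuals vanish, so the positive vector
  \<open>w\<close> is an eigenvector.\<close>

lemma spectral_radius_dumbbell_le:
  assumes "m \<ge> 3" and p: "p \<ge> 1"
    and root: "sinh (2 * s) * (2 * tanh (real m * s) + tanh (real p * s)) = cosh (2 * s)"
  shows "graph_spectral_radius (B_graph m p m) \<le> 2 * cosh (2 * s)"
proof -
  define N y z where "N = m + p + m - 1" "y = m - 1" "z = m - 1 + p"
  interpret chord_model N y z s
    using assms by unfold_locales (auto simp: N_y_z_def)
  have eq: "B_graph m p m = \<lparr>pverts = {..<N}, parcs = chord_arcs N y z\<rparr>"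
    using B_graph_eq[of m m p] assms by (simp add: N_y_z_def)
  have yz: "y < z" using assms by (simp add: N_y_z_def)
  have abc: "a = m" "b = p" "c = m"
    using assms unfolding a_def b_def c_def by (auto simp: N_y_z_def)
  have "2 * arc_weight s m 1 + arc_weight s p 1 - 2 * cosh (2 * s) = 0"
    unfolding arc_weight_1 using root by (simp add: algebra_simps)
  then have "defect y = 0" "defect z = 0" using defect_dumbbell[OF yz] unfolding abc by simp_all
  then have "defect i = 0" if "i < N" for i using defect_0[OF that] by blast
  then show ?thesis
    using w_pos bounds sym_chord_arcs
    by (intro graph_spectral_radius_le[where f = w]) (auto simp: eq defect_def)
qed

text \<open>\<open>T\<close> stands for the \<open>tanh\<close> sum of the claimed minimiser. An
  even length among \<open>a\<close> and \<open>c\<close> forces an edge outside the lollipop; its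
  contribution is at least \<open>?Q * ?Q\<close>, while the gain over \<open>T\<close> allows only
  less.\<close>

lemma (in lollipop_graph) no_better_triple:
  assumes N: "N = card V" "\<not> (odd a \<and> odd c)" and L: "a \<le> i + 2" "b \<le> i + 2" "c \<le> i + 2"
    and s2: "exp (2 * s) < 2"
    and root: "cosh (2 * s) = sinh (2 * s) * T"
    and gap: "tanh (real a * s) + tanh (real b * s) + tanh (real c * s) - T \<le>
      2 * tanh (real (i + 1) * s) - tanh (real i * s) - tanh (real (i + 2) * s)"
  shows False
proof -
  let ?Q = "1 / cosh (real (i + 2) * s)"
  let ?S = "tanh (real a * s) + tanh (real b * s) + tanh (real c * s)"
  obtain j k where jk: "cosh (2 * s) + w j * w k \<le> sinh (2 * s) * ?S"
    using extra_edge_if_even[OF N] by blast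
  have "?Q * ?Q \<le> w j * w k"
    using weight_ge[OF L] by (intro mult_mono) (auto simp: less_imp_le[OF w_pos])
  also have "\<dots> \<le> sinh (2 * s) * (?S - T)" using jk root by (simp add: algebra_simps)
  also have "\<dots> \<le> sinh (2 * s) * (2 * tanh (real (i + 1) * s) - tanh (real i * s) - tanh (real (i + 2) * s))"
    using gap s_pos by (intro mult_left_mono) auto
  also have "\<dots> < 1 / (cosh (real (i + 2) * s))\<^sup>2" by (rule tanh_concavity_gap_less[OF s_pos s2])
  also have "\<dots> = ?Q * ?Q" by (simp add: power2_eq_square)
  finally show False by simp
qed

lemma (in lollipop_graph) iso_dumbbell_if_extremal:
  assumes "pair_graph G" and VE: "V = pverts G" "E = parcs G"
    and "cosh (2 * s) = sinh (2 * s) * (tanh (real a * s) + tanh (real b * s) + tanh (real c * s))"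
  shows "a = c" "odd a" "digraph_iso (with_proj G) (with_proj (B_graph a b c))"
proof -
  note ex = extremal[OF assms(4)]
  show "a = c" "odd a" by (fact ex(4), fact ex(5))
  have "a + b + c - 1 = N" "a - 1 = y" "a - 1 + b = z" "1 \<le> a" "1 \<le> c"
    using ex(3) bounds unfolding a_def b_def c_def by auto
  then have "B_graph a b c = \<lparr>pverts = {..<N}, parcs = pullback N h E\<rparr>"
    unfolding ex(1) using B_graph_eq[of a c b] by simp
  then show "digraph_iso (with_proj G) (with_proj (B_graph a b c))"
    using assms(1) inj ex(2) unfolding VE by (intro digraph_iso_of_enumeration)
qed

text \<open>
  Up to order, at most one triple of lengths other than \<open>(m, p, m)\<close> has a \<open>tanh\<close> sum that is not
  smaller. It uses all vertices and contains two equal even numbers, so an additional edge is needed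
  to keep the independence number small, and this edge outweighs the gain in the sum.
\<close>

lemma even_order_extremal:
  assumes G: "G \<in> connected_graphs n (\<lceil>real n / 2\<rceil> - 1)"
    and min: "\<And>H :: nat pair_pre_digraph. H \<in> connected_graphs n (\<lceil>real n / 2\<rceil> - 1) \<Longrightarrow>
           graph_spectral_radius G \<le> graph_spectral_radius H"
    and mp: "odd m" "m \<ge> 3" "odd p" "p \<ge> 3" "n = 2 * m + p - 1"
      "p = m \<or> p + 2 = m \<or> p = m + 2"
  shows "digraph_iso (with_proj G) (with_proj (B_graph m p m))"
proof -
  have n: "even n" "n > 0" using mp by auto
  obtain s where s: "s > 0" "exp (2 * s) < 2"
    and root: "sinh (2 * s) * (2 * tanh (real m * s) + tanh (real p * s)) = cosh (2 * s)"
    using ex_tanh_root[OF mp(2,4)] by blast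
  have "p \<ge> 1" using mp by simp
  have "graph_spectral_radius G \<le> graph_spectral_radius (B_graph m p m)"
    by (rule min[OF odd_dumbbell_in_connected_graphs[OF mp(1,2,3,5)]])
  also have "\<dots> \<le> 2 * cosh (2 * s)"
    by (rule spectral_radius_dumbbell_le[OF mp(2) \<open>p \<ge> 1\<close> root])
  finally obtain N y z h where "lollipop_graph N y z s (pverts G) (parcs G) h"
    using ex_lollipop_graph[OF G n s(1)] by blast
  then interpret lollipop_graph N y z s "pverts G" "parcs G" h .
  interpret F: concave_sequence "\<lambda>l. tanh (real l * s)" by (rule concave_sequence_tanh[OF s(1)])
  have pg: "pair_graph G" and card: "card (pverts G) = n"
    using G by (simp_all add: connected_graphs_def)
  have total: "a + b + c \<le> n + 1" using abc(3) N_le card by simp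
  let ?T = "\<lambda>l. tanh (real l * s)"
  have "sinh (2 * s) * (2 * ?T m + ?T p) \<le> sinh (2 * s) * (?T a + ?T b + ?T c)"
    using tanh_sum_ge root by simp
  then have ge: "?T a + ?T b + ?T c \<ge> 2 * ?T m + ?T p"
    using s by (simp add: mult_le_cancel_left)
  \<comment> \<open>The sum does not see the order of the lengths; \<open>a = c\<close> then selects
    \<open>(m, p, m)\<close>.\<close>
  have good: "digraph_iso (with_proj G) (with_proj (B_graph m p m))"
    if abc_m: "(a, b, c) \<in> {(m, m, p), (m, p, m), (p, m, m)}"
  proof -
    have "cosh (2 * s) = sinh (2 * s) * (?T a + ?T b + ?T c)"
      using abc_m root by (auto simp: algebra_simps)
    from iso_dumbbell_if_extremal[OF pg refl refl this] abc_m show ?thesis by auto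
  qed
  show ?thesis
    using mp(6)
  proof (elim disjE)
    assume pm: "p = m"
    have "a = m \<and> b = m \<and> c = m"
      using total ge mp pm by (intro F.sum3_max_0) auto
    then show ?thesis using good pm by simp
  next
    assume pm: "p = m + 2"
    have "(a, b, c) \<in> {(m, m+1, m+1), (m+1, m, m+1), (m+1, m+1, m), (m, m, m+2), (m, m+2, m), (m+2, m, m)}"
      using total ge mp pm by (intro F.sum3_max_2) auto
    moreover have False if bad: "(a, b, c) \<in> {(m, m+1, m+1), (m+1, m, m+1), (m+1, m+1, m)}"
    proof (rule no_better_triple[OF _ _ _ _ _ s(2) root[symmetric], where i = m])
      show "N = card (pverts G)" using bad abc(3) card mp pm by auto
      show "\<not> (odd a \<and> odd c)" using bad mp(1) by auto
      \<comment> \<open>This is an equality: the lengths \<open>m\<close> and \<open>m + 2\<close>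
        have become two lengths \<open>m + 1\<close>.\<close>
      show "?T a + ?T b + ?T c - (2 * ?T m + ?T p) \<le> 2 * ?T (m + 1) - ?T m - ?T (m + 2)"
        using bad pm by auto
    qed (use bad in auto)
    ultimately show ?thesis using good pm by auto
  next
    assume pm: "p + 2 = m"
    have "(a, b, c) \<in> {(p+1, p+1, p+2), (p+1, p+2, p+1), (p+2, p+1, p+1), (p, p+2, p+2), (p+2, p, p+2), (p+2, p+2, p)}"
    proof (rule F.sum3_max_1)
      show "a + b + c \<le> 3 * p + 4" using total mp(5) pm by simp
      show "?T p + 2 * ?T (p + 2) \<le> ?T a + ?T b + ?T c" using ge pm by simp
      show "F.slope p < 2 * F.slope (p + 1)"
        using tanh_slope_less[OF s, of p] by (simp add: F.slope_def)
    qed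
    moreover have False if bad: "(a, b, c) \<in> {(p+1, p+1, p+2), (p+1, p+2, p+1), (p+2, p+1, p+1)}"
    proof (rule no_better_triple[OF _ _ _ _ _ s(2) root[symmetric], where i = p])
      show "N = card (pverts G)" using bad abc(3) card mp pm by auto
      show "\<not> (odd a \<and> odd c)" using bad mp(3) by auto
      show "?T a + ?T b + ?T c - (2 * ?T m + ?T p) \<le> 2 * ?T (p + 1) - ?T p - ?T (p + 2)"
        using bad pm by auto
    qed (use bad in auto)
    ultimately show ?thesis using good pm by auto
  qed
qed

theorem theorem1p1:
  fixes n k :: nat and G :: "'a pair_pre_digraph"
  assumes "n \<ge> 7"
    and "int k = \<lceil>real n / 3\<rceil>"
    and "G \<in> connected_graphs n (\<lceil>real n / 2\<rceil> - 1)"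
    and "\<And>H :: nat pair_pre_digraph. H \<in> connected_graphs n (\<lceil>real n / 2\<rceil> - 1) \<Longrightarrow>
           graph_spectral_radius G \<le> graph_spectral_radius H"
  shows "(odd n \<longrightarrow> digraph_iso (with_proj G) (with_proj (cycle_graph n))) \<and>
         (n mod 6 = 0 \<longrightarrow> digraph_iso (with_proj G) (with_proj (B_graph (k + 1) (k - 1) (k + 1)))) \<and>
         (n mod 6 = 2 \<longrightarrow> digraph_iso (with_proj G) (with_proj (B_graph k k k))) \<and>
         (n mod 6 = 4 \<longrightarrow> digraph_iso (with_proj G) (with_proj (B_graph (k - 1) (k + 1) (k - 1))))"
proof (intro conjI impI)
  have k: "k = l" if "real n / 3 \<le> real l" "real l - 1 < real n / 3" for l
  proof -
    have "\<lceil>real n / 3\<rceil> = int l" using that by (intro ceiling_unique) auto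
    then show ?thesis using assms(2) by simp
  qed
  note iso = even_order_extremal[OF assms(3,4)]
  define j where "j = n div 6"
  {
    assume "odd n"
    have "n \<ge> 3" using assms(1) by simp
    have "graph_spectral_radius G \<le> 2"
      using assms(4)[OF cycle_graph_in_connected_graphs[OF \<open>odd n\<close> \<open>n \<ge> 3\<close>]]
        spectral_radius_cycle_graph_le[OF \<open>n \<ge> 3\<close>] by linarith
    then show "digraph_iso (with_proj G) (with_proj (cycle_graph n))"
      by (rule odd_order_extremal[OF assms(3) \<open>odd n\<close> \<open>n \<ge> 3\<close>])
  next
    assume "n mod 6 = 0"
    then have n: "n = 6 * j" using div_mult_mod_eq[of n 6] by (simp add: j_def)
    \<comment> \<open>Excluding \<open>n = 6\<close> gives \<open>j \<ge> 2\<close>, so the path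
      length \<open>k - 1 = 2 * j - 1\<close> is at least 3, as \<open>ex_tanh_root\<close>
      requires.\<close>
    then have "j \<ge> 2" "k = 2 * j" using assms(1) by (simp, intro k) auto
    then show "digraph_iso (with_proj G) (with_proj (B_graph (k + 1) (k - 1) (k + 1)))"
      using n by (intro iso) auto
  next
    assume "n mod 6 = 2"
    then have n: "n = 6 * j + 2" using div_mult_mod_eq[of n 6] by (simp add: j_def)
    then have "j \<ge> 1" "k = 2 * j + 1" using assms(1) by (simp, intro k) auto
    then show "digraph_iso (with_proj G) (with_proj (B_graph k k k))"
      using n by (intro iso) auto
  next
    assume "n mod 6 = 4"
    then have n: "n = 6 * j + 4" using div_mult_mod_eq[of n 6] by (simp add: j_def)
    then have "j \<ge> 1" "k = 2 * j + 2" using assms(1) by (simp, intro k) auto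
    then show "digraph_iso (with_proj G) (with_proj (B_graph (k - 1) (k + 1) (k - 1)))"
      using n by (intro iso) auto
  }
qed

end
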